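(* Let $p^\star\in\mathbb{R}^{d|\mathcal{V}|}$ be a target formation such that $(\mathcal{G},p^\star)$ is a $\tau(\Gamma)$-symmetric isostatic framework whose symmetry is free, and let the desired distances be those of $p^\star$, i.e. the entry of $\mathbf{d}_0^2$ at the edge $i\gamma(j)\in\mathcal{E}_0$ is $\|p^\star_i-\tau(\gamma)p^\star_j\|^2=\|p_i^\star-p^\star_{\gamma(j)}\|^2$. Assume that the subgraph $\mathcal{G}(\Gamma_i)$ of $\mathcal{G}$ induced by each vertex orbit $\Gamma_i$ is connected, and that the matrices $E(\Gamma_i)$ are constructed using only the edges of a spanning tree of $\mathcal{G}(\Gamma_i)$. Consider the closed-loop system $$\begin{bmatrix}\dot p_0(t)\\ \dot p_f(t)\end{bmatrix}=\begin{bmatrix}-\mathcal{O}(\mathcal{G}_0,p_0(t))^T\big(\mathcal{O}(\mathcal{G}_0,p_0(t))p_0(t)-\mathbf{d}_0^2\big)\\ 0\end{bmatrix}-PQP^T\begin{bmatrix}p_0(t)\\ p_f(t)\end{bmatrix}$$ and the error $\bar e(t)=(\bar\sigma(t),\bar q(t))$ with $\bar\sigma(t)=\mathcal{O}(\mathcal{G}_0,p_0(t))p_0(t)-\mathbf{d}_0^2$, $\bar q(t)=\bar E(\Gamma)^Tp(t)$, which evolves according to (with $\mathcal{O}=\mathcal{O}(\mathcal{G}_0,p_0(t))$) $$\dot{\bar\sigma}=-2\big(\mathcal{O}\mathcal{O}^T\bar\sigma+\mathcal{O}\bar E_0(\Gamma)\bar q\big),\qquad \dot{\bar q}=-\big(\bar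 E_0(\Gamma)^T\mathcal{O}^T\bar\sigma+\bar E(\Gamma)^T\bar E(\Gamma)\bar q\big).$$ Then the origin $\bar e=0$ is a locally exponentially stable equilibrium of the error system; that is, there are a neighbourhood $U$ of $p^\star$ and constants $C,\lambda>0$ such that every solution with $p(0)\in U$ satisfies $\|\bar e(t)\|\le Ce^{-\lambda t}\|\bar e(0)\|$ for all $t\ge 0$.
   Context: Graph and symmetry. $\mathcal{G}=(\mathcal{V},\mathcal{E})$ is a finite simple graph and $\Gamma$ is a subgroup of $\mathrm{Aut}(\mathcal{G})$ (we say $\mathcal{G}$ is $\Gamma$-symmetric). The symmetry is free: $\gamma(i)\neq i$ for all $i\in\mathcal{V}$ and all non-identity $\gamma\in\Gamma$. $\tau:\Gamma\to O(\mathbb{R}^d)$ is a homomorphism into the orthogonal group. A framework $(\mathcal{G},p)$, $p:\mathcal{V}\to\mathbb{R}^d$ (also viewed as a point of $\mathbb{R}^{d|\mathcal{V}|}$), is $\tau(\Gamma)$-symmetric if $\tau(\gamma)p_i=p_{\gamma(i)}$ for all $\gamma\in\Gamma$, $i\in\mathcal{V}$. Symmetric isostaticity. An infinitesimal motion of $(\mathcal{G},p)$ is $u:\mathcal{V}\to\mathbb{R}^d$ with $\langle p_i-p_j,u_i-u_j\rangle=0$ for all $ij\in\mathcal{E}$; it is trivial if there are a skew-symmetric matrix $S$ and a vector $c$ with $u_i=Sp_i+c$ for all $i$; it is $\tau(\Gamma)$-symmetric if $\tau(\gamma)u_i=u_{\gamma(i)}$ for all $\gamma,i$. A self-stress is $\omega:\mathcal{E}\to\mathbb{R}$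 with $\sum_{j:ij\in\mathcal{E}}\omega_{ij}(p_i-p_j)=0$ for every $i$; it is $\tau(\Gamma)$-symmetric if $\omega_{\gamma(e)}=\omega_e$ for all $\gamma\in\Gamma$, $e\in\mathcal{E}$. A $\tau(\Gamma)$-symmetric framework is $\tau(\Gamma)$-symmetric isostatic if every $\tau(\Gamma)$-symmetric infinitesimal motion is trivial and it has no non-zero $\tau(\Gamma)$-symmetric self-stress. Orbits. The vertex orbit of $i$ is $\Gamma_i=\{\gamma(i):\gamma\in\Gamma\}$; the edge orbit of $ij$ is $\{\gamma(i)\gamma(j):\gamma\in\Gamma\}$. $\mathcal{V}_0$ is a set of representatives, one for each vertex orbit. $\mathcal{E}_0$ is a set of representatives, one for each edge orbit, each of the form $i\gamma(j)$ with $i,j\in\mathcal{V}_0$, $\gamma\in\Gamma$. For $u,v$ in the same vertex orbit, $\gamma_{uv}$ is the (unique) element of $\Gamma$ with $\gamma_{uv}(u)=v$. The quotient $\Gamma$-gain graph $\mathcal{G}_0=(\mathcal{V}_0,\mathcal{E}_0)$ is the directed multigraph with vertex set $\mathcal{V}_0$ and, for each edge orbit representative $i\gamma(j)$, a directed edge $((i,j);\gamma)$ with label $\gamma$. Orbit rigidity matrix. For $\bar p=(\bar p_i)_{i\in\mathcal{V}_0}$, $\mathcal{O}(\mathcal{G}_0,\bar p)$ is the $|\mathcal{E}_0|\times d|\mathcal{V}_0|$ matrix whose row for an edge $((i,j);\gamma)$ with $i\ne j$ has $(\bar p_i-\tau(\gamma)\bar p_j)^T$ in the $d$ columns of $i$,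 $(\bar p_j-\tau(\gamma)^{-1}\bar p_i)^T$ in the $d$ columns of $j$, and zeros elsewhere; the row for a loop $((i,i);\gamma)$ has $(2\bar p_i-\tau(\gamma)\bar p_i-\tau(\gamma)^{-1}\bar p_i)^T$ in the columns of $i$ and zeros elsewhere. Dynamics. The vertices are ordered so that vertices of the same orbit are consecutive. $P$ is the permutation matrix with $Pp=(p_0^T,p_f^T)^T$, where $p_0$ is the restriction of $p$ to $\mathcal{V}_0$ and $p_f$ collects the remaining agents. For $i\in\mathcal{V}_0$ the edges of the chosen spanning tree of $\mathcal{G}(\Gamma_i)$ are oriented arbitrarily; $E(\Gamma_i)$ is the block matrix with $d\times d$ blocks, with block rows indexed by $\Gamma_i$ and block columns by these tree edges: for an edge $k$ oriented from $u$ to $v$, $[E(\Gamma_i)]_{uk}=I$, $[E(\Gamma_i)]_{vk}=-\tau(\gamma_{uv})$, and all other blocks of column $k$ are $0$. $\bar E(\Gamma)$ is the block-diagonal matrix with blocks $E(\Gamma_i)$, $i\in\mathcal{V}_0$; $Q=\bar E(\Gamma)\bar E(\Gamma)^T$; and $\begin{bmatrix}\bar E_0(\Gamma)\\ \bar E_f(\Gamma)\end{bmatrix}=P\bar E(\Gamma)$, partitioned conformally with $(p_0,p_f)$. *)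

theory Defs
  imports "HOL-Analysis.Analysis" "HOL-Algebra.Group"
begin

section \<open>Graphs and symmetry\<close>

text \<open>
  The vertex set is the finite type \<open>'v\<close>, an undirected edge is a two-element set of vertices, and
  a point of \<open>R^(d|V|)\<close> is an element of \<open>(real^'d)^'v\<close>.
\<close>

definition simple_graph :: "'v set set \<Rightarrow> bool" where
  "simple_graph E \<longleftrightarrow> (\<forall>e\<in>E. card e = 2)"

definition aut_group :: "'v set set \<Rightarrow> ('v \<Rightarrow> 'v) monoid" where
  "aut_group E =
     \<lparr> carrier = {\<gamma>. bij \<gamma> \<and> (\<forall>i j. {\<gamma> i, \<gamma> j} \<in> E \<longleftrightarrow> {i, j} \<in> E)},
       mult = (\<lambda>\<gamma> \<delta>. \<gamma> \<circ> \<delta>), one = id \<rparr>"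

definition orthogonal_group :: "(real^'d^'d) monoid" where
  "orthogonal_group = \<lparr> carrier = {A. orthogonal_matrix A}, mult = (**), one = mat 1 \<rparr>"

definition free_symmetry :: "('v \<Rightarrow> 'v) set \<Rightarrow> bool" where
  "free_symmetry \<Gamma> \<longleftrightarrow> (\<forall>\<gamma>\<in>\<Gamma>. \<gamma> \<noteq> id \<longrightarrow> (\<forall>i. \<gamma> i \<noteq> i))"

definition vertex_orbit :: "('v \<Rightarrow> 'v) set \<Rightarrow> 'v \<Rightarrow> 'v set" where
  "vertex_orbit \<Gamma> i = {\<gamma> i |\<gamma>. \<gamma> \<in> \<Gamma>}"

definition edge_orbit :: "('v \<Rightarrow> 'v) set \<Rightarrow> 'v set \<Rightarrow> 'v set set" where
  "edge_orbit \<Gamma> e = {\<gamma> ` e |\<gamma>. \<gamma> \<in> \<Gamma>}"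

definition vertex_representatives :: "('v \<Rightarrow> 'v) set \<Rightarrow> 'v set \<Rightarrow> bool" where
  "vertex_representatives \<Gamma> V0 \<longleftrightarrow> (\<forall>v. \<exists>!i. i \<in> V0 \<and> v \<in> vertex_orbit \<Gamma> i)"

text \<open>
  A gain edge \<open>(i, j, \<gamma>)\<close> is the directed edge \<open>((i,j);\<gamma>)\<close> coming from the edge orbit
  representative \<open>{i, \<gamma> j}\<close>. If both end points of a representative lie in \<open>V0\<close>, the
  representative can be written in two ways; the triple records which one was chosen.
\<close>

type_synonym 'v gain_edge = "'v \<times> 'v \<times> ('v \<Rightarrow> 'v)"

definition edge_of_gain :: "'v gain_edge \<Rightarrow> 'v set" where
  "edge_of_gain = (\<lambda>(i, j, \<gamma>). {i, \<gamma> j})"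

definition edge_representatives ::
  "'v set set \<Rightarrow> ('v \<Rightarrow> 'v) set \<Rightarrow> 'v set \<Rightarrow> 'v gain_edge set \<Rightarrow> bool" where
  "edge_representatives E \<Gamma> V0 E0 \<longleftrightarrow>
     E0 \<subseteq> V0 \<times> V0 \<times> \<Gamma> \<and>
     (\<forall>g\<in>E0. edge_of_gain g \<in> E) \<and>
     (\<forall>e\<in>E. \<exists>!g. g \<in> E0 \<and> e \<in> edge_orbit \<Gamma> (edge_of_gain g))"

text \<open>The element written \<open>\<gamma>\<close> with subscript \<open>uv\<close>; unique for a free symmetry.\<close>

definition gamma_between :: "('v \<Rightarrow> 'v) set \<Rightarrow> 'v \<Rightarrow> 'v \<Rightarrow> 'v \<Rightarrow> 'v" where
  "gamma_between \<Gamma> u v = (THE \<gamma>. \<gamma> \<in> \<Gamma> \<and> \<gamma> u = v)"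


section \<open>Symmetric isostaticity\<close>

definition symmetric_vectors ::
  "('v \<Rightarrow> 'v) set \<Rightarrow> (('v \<Rightarrow> 'v) \<Rightarrow> real^'d^'d) \<Rightarrow> (real^'d)^('v::finite) \<Rightarrow> bool" where
  "symmetric_vectors \<Gamma> \<tau> p \<longleftrightarrow> (\<forall>\<gamma>\<in>\<Gamma>. \<forall>i. \<tau> \<gamma> *v (p $ i) = p $ (\<gamma> i))"

definition infinitesimal_motion ::
  "'v set set \<Rightarrow> (real^'d)^('v::finite) \<Rightarrow> (real^'d)^'v \<Rightarrow> bool" where
  "infinitesimal_motion E p u \<longleftrightarrow>
     (\<forall>i j. {i, j} \<in> E \<longrightarrow> (p $ i - p $ j) \<bullet> (u $ i - u $ j) = 0)"

definition trivial_motion :: "(real^'d)^('v::finite) \<Rightarrow> (real^'d)^'v \<Rightarrow> bool" where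
  "trivial_motion p u \<longleftrightarrow>
     (\<exists>(S :: real^'d^'d) c. transpose S = - S \<and> (\<forall>i. u $ i = S *v (p $ i) + c))"

definition self_stress :: "'v set set \<Rightarrow> (real^'d)^('v::finite) \<Rightarrow> ('v set \<Rightarrow> real) \<Rightarrow> bool" where
  "self_stress E p \<omega> \<longleftrightarrow> (\<forall>i. (\<Sum>j | {i, j} \<in> E. \<omega> {i, j} *\<^sub>R (p $ i - p $ j)) = 0)"

definition symmetric_stress ::
  "'v set set \<Rightarrow> ('v \<Rightarrow> 'v) set \<Rightarrow> ('v set \<Rightarrow> real) \<Rightarrow> bool" where
  "symmetric_stress E \<Gamma> \<omega> \<longleftrightarrow> (\<forall>\<gamma>\<in>\<Gamma>. \<forall>e\<in>E. \<omega> (\<gamma> ` e) = \<omega> e)"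

definition symmetric_isostatic ::
  "'v set set \<Rightarrow> ('v \<Rightarrow> 'v) set \<Rightarrow> (('v \<Rightarrow> 'v) \<Rightarrow> real^'d^'d) \<Rightarrow> (real^'d)^('v::finite) \<Rightarrow> bool" where
  "symmetric_isostatic E \<Gamma> \<tau> p \<longleftrightarrow>
     symmetric_vectors \<Gamma> \<tau> p \<and>
     (\<forall>u. infinitesimal_motion E p u \<and> symmetric_vectors \<Gamma> \<tau> u \<longrightarrow> trivial_motion p u) \<and>
     (\<forall>\<omega>. self_stress E p \<omega> \<and> symmetric_stress E \<Gamma> \<omega> \<longrightarrow> (\<forall>e\<in>E. \<omega> e = 0))"


section \<open>Connectedness and spanning trees\<close>

definition induced_edges :: "'v set set \<Rightarrow> 'v set \<Rightarrow> 'v set set" where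
  "induced_edges E W = {e\<in>E. e \<subseteq> W}"

definition connected_graph :: "'v set \<Rightarrow> 'v set set \<Rightarrow> bool" where
  "connected_graph W F \<longleftrightarrow> (\<forall>u\<in>W. \<forall>v\<in>W. (u, v) \<in> {(a, b). {a, b} \<in> F}\<^sup>*)"

definition is_cycle :: "'v set set \<Rightarrow> 'v list \<Rightarrow> bool" where
  "is_cycle F vs \<longleftrightarrow> length vs \<ge> 3 \<and> distinct vs \<and>
     (\<forall>k. Suc k < length vs \<longrightarrow> {vs ! k, vs ! Suc k} \<in> F) \<and> {last vs, hd vs} \<in> F"

definition spanning_tree :: "'v set \<Rightarrow> 'v set set \<Rightarrow> 'v set set \<Rightarrow> bool" where
  "spanning_tree W F T \<longleftrightarrow> T \<subseteq> F \<and> connected_graph W T \<and> (\<nexists>vs. is_cycle T vs)"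

definition oriented_spanning_tree :: "'v set \<Rightarrow> 'v set set \<Rightarrow> ('v \<times> 'v) set \<Rightarrow> bool" where
  "oriented_spanning_tree W F A \<longleftrightarrow>
     (\<forall>u v. (u, v) \<in> A \<longrightarrow> (v, u) \<notin> A) \<and> spanning_tree W F {{u, v} |u v. (u, v) \<in> A}"


section \<open>Block matrices\<close>

text \<open>
  A matrix with \<open>d \<times> d\<close> blocks is a function of its block row and block column index, and a block
  vector is a function of its block index; products sum over an explicit index set. No ordering of
  the indices is needed.
\<close>

type_synonym ('r, 'c, 'd) block_matrix = "'r \<Rightarrow> 'c \<Rightarrow> real^'d^'d"

definition bmult ::
  "'k set \<Rightarrow> ('r, 'k, 'd::finite) block_matrix \<Rightarrow> ('k, 'c, 'd) block_matrix \<Rightarrow> ('r, 'c, 'd) block_matrix" where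
  "bmult K A B = (\<lambda>r c. \<Sum>k\<in>K. A r k ** B k c)"

definition btranspose :: "('r, 'c, 'd::finite) block_matrix \<Rightarrow> ('c, 'r, 'd) block_matrix" where
  "btranspose A = (\<lambda>c r. transpose (A r c))"

definition bapply ::
  "'c set \<Rightarrow> ('r, 'c, 'd::finite) block_matrix \<Rightarrow> ('c \<Rightarrow> real^'d) \<Rightarrow> 'r \<Rightarrow> real^'d" where
  "bapply C A x = (\<lambda>r. \<Sum>c\<in>C. A r c *v x c)"


section \<open>The orbit rigidity matrix\<close>

text \<open>
  \<open>orbit_rigidity \<tau> x g k\<close> is the \<open>1 \<times> d\<close> block in the row of the gain edge \<open>g\<close> and the
  \<open>d\<close> columns of the vertex \<open>k\<close>; the rows are indexed by \<open>E0\<close> and the block columns by \<open>V0\<close>.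
\<close>

fun orbit_rigidity ::
  "(('v \<Rightarrow> 'v) \<Rightarrow> real^'d^'d) \<Rightarrow> ('v \<Rightarrow> real^'d) \<Rightarrow> 'v gain_edge \<Rightarrow> 'v \<Rightarrow> real^'d" where
  "orbit_rigidity \<tau> x (i, j, \<gamma>) k =
     (if i = j then
        (if k = i then 2 *\<^sub>R x i - \<tau> \<gamma> *v x i - matrix_inv (\<tau> \<gamma>) *v x i else 0)
      else if k = i then x i - \<tau> \<gamma> *v x j
      else if k = j then x j - matrix_inv (\<tau> \<gamma>) *v x i
      else 0)"

definition rigidity_apply ::
  "'v set \<Rightarrow> (('v \<Rightarrow> 'v) \<Rightarrow> real^'d^'d) \<Rightarrow> ('v \<Rightarrow> real^'d) \<Rightarrow> ('v \<Rightarrow> real^'d) \<Rightarrow> 'v gain_edge \<Rightarrow> real" where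
  "rigidity_apply V0 \<tau> x y = (\<lambda>g. \<Sum>k\<in>V0. orbit_rigidity \<tau> x g k \<bullet> y k)"

definition rigidity_transpose_apply ::
  "'v gain_edge set \<Rightarrow> (('v \<Rightarrow> 'v) \<Rightarrow> real^'d^'d) \<Rightarrow> ('v \<Rightarrow> real^'d) \<Rightarrow> ('v gain_edge \<Rightarrow> real)
     \<Rightarrow> 'v \<Rightarrow> real^'d" where
  "rigidity_transpose_apply E0 \<tau> x s = (\<lambda>k. \<Sum>g\<in>E0. s g *\<^sub>R orbit_rigidity \<tau> x g k)"

fun squared_distance ::
  "(('v \<Rightarrow> 'v) \<Rightarrow> real^'d^'d) \<Rightarrow> (real^'d)^('v::finite) \<Rightarrow> 'v gain_edge \<Rightarrow> real" where
  "squared_distance \<tau> p (i, j, \<gamma>) = (norm (p $ i - \<tau> \<gamma> *v (p $ j)))\<^sup>2"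


section \<open>The symmetry-forcing matrices\<close>

text \<open>
  \<open>T i\<close> is the set of oriented edges of the spanning tree of the subgraph induced by the orbit
  of \<open>i\<close>. The block columns of \<open>Ebar\<close> are the pairs \<open>(i, k)\<close> with \<open>i \<in> V0\<close> and \<open>k \<in> T i\<close>.
\<close>

fun E_orbit ::
  "('v \<Rightarrow> 'v) set \<Rightarrow> (('v \<Rightarrow> 'v) \<Rightarrow> real^'d^'d) \<Rightarrow> ('v, 'v \<times> 'v, 'd::finite) block_matrix" where
  "E_orbit \<Gamma> \<tau> w (u, v) =
     (if w = u then mat 1 else if w = v then - \<tau> (gamma_between \<Gamma> u v) else 0)"

type_synonym 'v tree_column = "'v \<times> ('v \<times> 'v)"

definition tree_columns :: "'v set \<Rightarrow> ('v \<Rightarrow> ('v \<times> 'v) set) \<Rightarrow> 'v tree_column set" where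
  "tree_columns V0 T = Sigma V0 T"

fun Ebar ::
  "('v \<Rightarrow> 'v) set \<Rightarrow> (('v \<Rightarrow> 'v) \<Rightarrow> real^'d^'d) \<Rightarrow> ('v, 'v tree_column, 'd::finite) block_matrix" where
  "Ebar \<Gamma> \<tau> w (i, k) = (if w \<in> vertex_orbit \<Gamma> i then E_orbit \<Gamma> \<tau> w k else 0)"

definition Qmat ::
  "('v \<Rightarrow> 'v) set \<Rightarrow> (('v \<Rightarrow> 'v) \<Rightarrow> real^'d^'d) \<Rightarrow> 'v set \<Rightarrow> ('v \<Rightarrow> ('v \<times> 'v) set)
     \<Rightarrow> ('v, 'v, 'd::finite) block_matrix" where
  "Qmat \<Gamma> \<tau> V0 T = bmult (tree_columns V0 T) (Ebar \<Gamma> \<tau>) (btranspose (Ebar \<Gamma> \<tau>))"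

text \<open>
  The stacked vector \<open>(p_0, p_f)\<close> has block index set \<open>V0 <+> - V0\<close>: \<open>Inl i\<close> is the position of
  \<open>i \<in> V0\<close> in \<open>p_0\<close>, and \<open>Inr i\<close> that of \<open>i \<notin> V0\<close> in \<open>p_f\<close>. The permutation matrix \<open>P\<close> has
  its rows indexed by this set and its columns by the vertices.
\<close>

definition stack_index :: "'v set \<Rightarrow> ('v + 'v) set" where
  "stack_index V0 = V0 <+> (- V0)"

definition Pmat :: "('v + 'v, 'v, 'd::finite) block_matrix" where
  "Pmat = (\<lambda>r v. if r = Inl v \<or> r = Inr v then mat 1 else 0)"

definition stacked :: "(real^'d)^('v::finite) \<Rightarrow> 'v + 'v \<Rightarrow> real^'d" where
  "stacked p = bapply UNIV Pmat (($) p)"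

definition p0_part :: "(real^'d)^('v::finite) \<Rightarrow> 'v \<Rightarrow> real^'d" where
  "p0_part p = (\<lambda>i. stacked p (Inl i))"

definition Ebar0 ::
  "('v::finite \<Rightarrow> 'v) set \<Rightarrow> (('v \<Rightarrow> 'v) \<Rightarrow> real^'d^'d) \<Rightarrow> ('v, 'v tree_column, 'd::finite) block_matrix" where
  "Ebar0 \<Gamma> \<tau> = (\<lambda>i. bmult UNIV Pmat (Ebar \<Gamma> \<tau>) (Inl i))"


section \<open>Closed-loop system and error system\<close>

definition sigma_bar ::
  "(('v::finite \<Rightarrow> 'v) \<Rightarrow> real^'d^'d) \<Rightarrow> 'v set \<Rightarrow> ('v gain_edge \<Rightarrow> real) \<Rightarrow> (real^'d)^'v
     \<Rightarrow> 'v gain_edge \<Rightarrow> real" where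
  "sigma_bar \<tau> V0 d2 p = (\<lambda>g. rigidity_apply V0 \<tau> (p0_part p) (p0_part p) g - d2 g)"

definition q_bar ::
  "('v::finite \<Rightarrow> 'v) set \<Rightarrow> (('v \<Rightarrow> 'v) \<Rightarrow> real^'d^'d) \<Rightarrow> (real^'d)^'v \<Rightarrow> 'v tree_column \<Rightarrow> real^'d" where
  "q_bar \<Gamma> \<tau> p = bapply UNIV (btranspose (Ebar \<Gamma> \<tau>)) (($) p)"

definition error_norm ::
  "'v set \<Rightarrow> 'v gain_edge set \<Rightarrow> ('v \<Rightarrow> ('v \<times> 'v) set) \<Rightarrow>
   ('v gain_edge \<Rightarrow> real) \<Rightarrow> ('v tree_column \<Rightarrow> real^'d) \<Rightarrow> real" where
  "error_norm V0 E0 T s q = sqrt ((\<Sum>g\<in>E0. (s g)\<^sup>2) + (\<Sum>k\<in>tree_columns V0 T. (norm (q k))\<^sup>2))"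

definition closed_loop_rhs ::
  "('v::finite \<Rightarrow> 'v) set \<Rightarrow> (('v \<Rightarrow> 'v) \<Rightarrow> real^'d^'d) \<Rightarrow> 'v set \<Rightarrow> 'v gain_edge set
     \<Rightarrow> ('v \<Rightarrow> ('v \<times> 'v) set) \<Rightarrow> ('v gain_edge \<Rightarrow> real) \<Rightarrow> (real^'d)^'v \<Rightarrow> 'v + 'v \<Rightarrow> real^'d" where
  "closed_loop_rhs \<Gamma> \<tau> V0 E0 T d2 p = (\<lambda>r.
     (case r of
        Inl i \<Rightarrow> - rigidity_transpose_apply E0 \<tau> (p0_part p) (sigma_bar \<tau> V0 d2 p) i
      | Inr i \<Rightarrow> 0)
     - bapply (stack_index V0)
         (bmult UNIV (bmult UNIV Pmat (Qmat \<Gamma> \<tau> V0 T)) (btranspose Pmat)) (stacked p) r)"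

definition closed_loop_solution ::
  "('v::finite \<Rightarrow> 'v) set \<Rightarrow> (('v \<Rightarrow> 'v) \<Rightarrow> real^'d^'d) \<Rightarrow> 'v set \<Rightarrow> 'v gain_edge set
     \<Rightarrow> ('v \<Rightarrow> ('v \<times> 'v) set) \<Rightarrow> ('v gain_edge \<Rightarrow> real) \<Rightarrow> real set \<Rightarrow> (real \<Rightarrow> (real^'d)^'v) \<Rightarrow> bool" where
  "closed_loop_solution \<Gamma> \<tau> V0 E0 T d2 J p \<longleftrightarrow>
     (\<forall>t\<in>J. \<forall>r\<in>stack_index V0.
        ((\<lambda>s. stacked (p s) r) has_vector_derivative closed_loop_rhs \<Gamma> \<tau> V0 E0 T d2 (p t) r)
          (at t within J))"

text \<open>
  Right-hand sides of the error system at the error \<open>(s, q)\<close>; the orbit rigidity matrix is taken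
  at \<open>x = p_0(t)\<close>.
\<close>

definition sigma_rhs ::
  "('v::finite \<Rightarrow> 'v) set \<Rightarrow> (('v \<Rightarrow> 'v) \<Rightarrow> real^'d^'d) \<Rightarrow> 'v set \<Rightarrow> 'v gain_edge set
     \<Rightarrow> ('v \<Rightarrow> ('v \<times> 'v) set) \<Rightarrow> ('v \<Rightarrow> real^'d)
     \<Rightarrow> ('v gain_edge \<Rightarrow> real) \<Rightarrow> ('v tree_column \<Rightarrow> real^'d) \<Rightarrow> 'v gain_edge \<Rightarrow> real" where
  "sigma_rhs \<Gamma> \<tau> V0 E0 T x s q = (\<lambda>g.
     - 2 * (rigidity_apply V0 \<tau> x (rigidity_transpose_apply E0 \<tau> x s) g
            + rigidity_apply V0 \<tau> x (bapply (tree_columns V0 T) (Ebar0 \<Gamma> \<tau>) q) g))"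

definition q_rhs ::
  "('v::finite \<Rightarrow> 'v) set \<Rightarrow> (('v \<Rightarrow> 'v) \<Rightarrow> real^'d^'d) \<Rightarrow> 'v set \<Rightarrow> 'v gain_edge set
     \<Rightarrow> ('v \<Rightarrow> ('v \<times> 'v) set) \<Rightarrow> ('v \<Rightarrow> real^'d)
     \<Rightarrow> ('v gain_edge \<Rightarrow> real) \<Rightarrow> ('v tree_column \<Rightarrow> real^'d) \<Rightarrow> 'v tree_column \<Rightarrow> real^'d" where
  "q_rhs \<Gamma> \<tau> V0 E0 T x s q = (\<lambda>k.
     - (bapply V0 (btranspose (Ebar0 \<Gamma> \<tau>)) (rigidity_transpose_apply E0 \<tau> x s) k
        + bapply (tree_columns V0 T) (bmult UNIV (btranspose (Ebar \<Gamma> \<tau>)) (Ebar \<Gamma> \<tau>)) q k))"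

end

theory Submission
  imports Defs
begin

text \<open>
  The closed loop is governed by one linear map. For a configuration \<open>x\<close>, \<open>dual_force x\<close> sends an
  error \<open>(\<sigma>, q)\<close> to the force \<open>(O\<^sup>T \<sigma>, 0) + Ebar q\<close> on the agents. The agents move with velocity
  \<open>p' = - dual_force e\<close> (\<open>closed_loop_derivative\<close>), while the errors change at the rates
  \<open>2 O p'\<close> and \<open>Ebar\<^sup>T p'\<close>, which are, up to the factor 2, the transpose of the same map. For
  \<open>W = \<bar>\<sigma>\<bar>\<^sup>2 / 4 + \<bar>q\<bar>\<^sup>2 / 2\<close> this gives \<open>W' = - \<bar>dual_force e\<bar>\<^sup>2\<close>
  (\<open>lyapunov_derivative\<close>).

  Everything therefore rests on \<open>dual_force\<close> being injective at the target
  (\<open>dual_force_injective\<close>). Suppose that the force of \<open>(\<sigma>, q)\<close> vanishes. Symmetric vectors are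
  orthogonal to the range of \<open>Ebar\<close> and take arbitrary values on \<open>V0\<close>, so testing with them shows
  \<open>O\<^sup>T \<sigma> = 0\<close> and then \<open>Ebar q = 0\<close>. A vector with \<open>O\<^sup>T \<sigma> = 0\<close> spreads over the group to a
  symmetric self-stress, which is zero for an isostatic framework (\<open>orbit_stress_trivial\<close>). The
  columns of \<open>Ebar\<close> come from forests, and peeling off leaves shows that they are independent
  (\<open>forest_incidence_injective\<close>).

  By continuity the force map stays bounded below in a ball around the target
  (\<open>dual_force_bounds_near\<close>). There \<open>W\<close> decays exponentially and the speed is at most a multiple of
  \<open>\<surd>W\<close>, so the path has a length proportional to the initial error. Starting close enough to the
  target, a solution never leaves the ball, and the decay persists (\<open>exponential_decay_in_ball\<close>).
\<close>

section \<open>Exponential decay inside a ball\<close>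

text \<open>
  Inside the ball the energy \<open>w\<close> decays like \<open>exp (- 2 c t)\<close>, so the speed is at most
  \<open>K exp (- c t) \<surd>(w 0)\<close> and the whole path has length at most \<open>K / c \<surd>(w 0)\<close>. The hypothesis
  \<open>init\<close> says that such a path is too short to leave the ball, so a first exit time cannot exist.
\<close>

lemma exponential_decay_in_ball:
  fixes p :: "real \<Rightarrow> 'a::real_normed_vector" and w :: "real \<Rightarrow> real"
  assumes J: "is_interval J" "0 \<in> J" "J \<subseteq> {0..}"
    and c: "c > 0" and K: "K \<ge> 0"
    and dp: "\<And>t. t \<in> J \<Longrightarrow> (p has_vector_derivative p' t) (at t within J)"
    and dw: "\<And>t. t \<in> J \<Longrightarrow> (w has_real_derivative w' t) (at t within J)"
    and nonneg: "\<And>t. t \<in> J \<Longrightarrow> 0 \<le> w t"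
    and decay: "\<And>t. t \<in> J \<Longrightarrow> dist (p t) a < \<rho> \<Longrightarrow> w' t \<le> - (2 * c * w t)"
    and speed: "\<And>t. t \<in> J \<Longrightarrow> dist (p t) a < \<rho> \<Longrightarrow> norm (p' t) \<le> K * sqrt (w t)"
    and init: "dist (p 0) a + K / c * sqrt (w 0) < \<rho>"
    and t: "t \<in> J"
  shows "w t \<le> exp (- (2 * c * t)) * w 0"
proof -
  have sub: "{0..s} \<subseteq> J" if "s \<in> J" for s
    using mem_is_interval_1_I[OF J(1) J(2) that] by auto
  have at_J: "at r within J = at r" if "s \<in> J" "0 < r" "r < s" for r s
    by (rule at_within_open_subset[of _ "{0<..<s}"]) (use that sub[of s] in auto)
  have cont_p: "continuous_on {0..s} p" if "s \<in> J" for s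
    unfolding continuous_on_eq_continuous_within
    using has_vector_derivative_continuous[OF has_vector_derivative_within_subset[OF dp sub[OF that]]] sub[OF that] by blast
  have cont_w: "continuous_on {0..s} w" if "s \<in> J" for s
    using continuous_on_subset[OF DERIV_continuous_on[OF dw] sub[OF that]] by blast
  have w_bound: "w s \<le> exp (- (2 * c * s)) * w 0"
    if s: "s \<in> J" and inside: "\<And>r. 0 \<le> r \<Longrightarrow> r < s \<Longrightarrow> dist (p r) a < \<rho>" for s
  proof -
    have "exp (2 * c * s) * w s \<le> exp (2 * c * 0) * w 0"
    proof (rule DERIV_nonpos_imp_decreasing_open[of 0 s "\<lambda>r. exp (2 * c * r) * w r"])
      show "0 \<le> s" using s J by auto
      show "continuous_on {0..s} (\<lambda>r. exp (2 * c * r) * w r)"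
        by (intro continuous_intros cont_w s)
      fix r assume r: "0 < r" "r < s"
      then have rJ: "r \<in> J" using sub[OF s] by auto
      have "(w has_real_derivative w' r) (at r)"
        using dw[OF rJ] at_J[OF s r] by simp
      then have "((\<lambda>r. exp (2 * c * r) * w r) has_real_derivative
          exp (2 * c * r) * (w' r + 2 * c * w r)) (at r)"
        by (auto intro!: derivative_eq_intros simp: algebra_simps)
      moreover have "exp (2 * c * r) * (w' r + 2 * c * w r) \<le> 0"
        using decay[OF rJ inside] r by (simp add: mult_le_0_iff)
      ultimately show "\<exists>y. ((\<lambda>r. exp (2 * c * r) * w r) has_real_derivative y) (at r) \<and> y \<le> 0"
        by blast
    qed
    then show ?thesis
      by (simp add: exp_minus field_simps)
  qed
  have p_bound: "dist (p s) (p 0) \<le> K / c * sqrt (w 0)"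
    if s: "s \<in> J" and inside: "\<And>r. 0 \<le> r \<Longrightarrow> r < s \<Longrightarrow> dist (p r) a < \<rho>" for s
  proof (cases "s = 0")
    case True
    then show ?thesis using c K nonneg J by simp
  next
    case False
    then have s0: "0 < s" using s J by force
    \<comment> \<open>The speed is compared with the derivative of \<open>- (K / c) \<surd>(w 0) exp (- c t)\<close>.\<close>
    let ?A = "K * sqrt (w 0)"
    have "norm (p s - p 0) \<le> - (?A / c) * exp (- (c * s)) - (- (?A / c) * exp (- (c * 0)))"
    proof (rule differentiable_bound_general[OF s0 cont_p[OF s], of "\<lambda>r. - (?A / c) * exp (- (c * r))"
            p' "\<lambda>r. ?A * exp (- (c * r))"])
      show "continuous_on {0..s} (\<lambda>r. - (?A / c) * exp (- (c * r)))"
        by (intro continuous_intros)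
      fix r assume r: "0 < r" "r < s"
      then have rJ: "r \<in> J" using sub[OF s] by auto
      show "(p has_vector_derivative p' r) (at r)"
        using dp[OF rJ] at_J[OF s r] by simp
      have "((\<lambda>r. - (?A / c) * exp (- (c * r))) has_real_derivative ?A * exp (- (c * r))) (at r)"
        using c by (auto intro!: derivative_eq_intros)
      then show "((\<lambda>r. - (?A / c) * exp (- (c * r))) has_vector_derivative ?A * exp (- (c * r))) (at r)"
        by (simp add: has_real_derivative_iff_has_vector_derivative)
      have "sqrt (w r) \<le> sqrt (exp (- (2 * c * r)) * w 0)"
        using w_bound[OF rJ] inside r by (intro real_sqrt_le_mono) auto
      also have "exp (- (2 * c * r)) = (exp (- (c * r)))\<^sup>2"
        by (simp add: power2_eq_square flip: exp_add)
      finally have "sqrt (w r) \<le> exp (- (c * r)) * sqrt (w 0)"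
        by (simp add: real_sqrt_mult)
      then have "K * sqrt (w r) \<le> ?A * exp (- (c * r))"
        using K by (metis mult.assoc mult.commute mult_left_mono)
      then show "norm (p' r) \<le> ?A * exp (- (c * r))"
        using speed[OF rJ inside] r by force
    qed
    also have "\<dots> \<le> ?A / c"
      using c K nonneg J by (auto intro!: mult_nonneg_nonneg divide_nonneg_pos)
    finally show ?thesis by (simp add: dist_norm)
  qed
  have inside: "dist (p s) a < \<rho>" if s: "s \<in> J" for s
  proof (rule ccontr)
    assume out: "\<not> dist (p s) a < \<rho>"
    \<comment> \<open>The minimum \<open>m\<close> of this set is the first exit time; the length estimate holds up to and including \<open>m\<close>.\<close>
    let ?S = "{r \<in> {0..s}. \<rho> \<le> dist (p r) a}"
    have "closed ?S"
      by (intro continuous_on_closed_Collect_le continuous_intros cont_p s closed_atLeastAtMost)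
    moreover have "bounded ?S"
      by (rule bounded_subset[of "{0..s}"]) auto
    ultimately have "compact ?S" by (simp add: compact_eq_bounded_closed)
    moreover have "s \<in> ?S" using out s J by auto
    ultimately obtain m where m: "m \<in> ?S" "\<And>r. r \<in> ?S \<Longrightarrow> m \<le> r"
      using compact_attains_inf[of ?S] by blast
    have mJ: "m \<in> J" using m sub[OF s] by auto
    have "dist (p r) a < \<rho>" if "0 \<le> r" "r < m" for r
      using m(1) m(2)[of r] that by force
    then have "dist (p m) (p 0) \<le> K / c * sqrt (w 0)"
      using p_bound[OF mJ] by blast
    then have "dist (p m) a < \<rho>"
      using init dist_triangle[of "p m" a "p 0"] by linarith
    with m show False by auto
  qed
  show "w t \<le> exp (- (2 * c * t)) * w 0"
    using w_bound[OF t] inside sub[OF t] by (meson atLeastAtMost_iff less_imp_le subsetD)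
qed

section \<open>Forests\<close>

lemma is_cycle_mono: "is_cycle F vs \<Longrightarrow> F \<subseteq> G \<Longrightarrow> is_cycle G vs"
  by (auto simp: is_cycle_def)

text \<open>
  The first vertex of a longest path is a leaf: a second edge at it either prolongs the path or
  leads back to the path and closes a cycle.
\<close>

lemma forest_has_leaf:
  fixes F :: "('v::finite) set set"
  assumes graph: "simple_graph F" and acyclic: "\<nexists>vs. is_cycle F vs" and nonempty: "F \<noteq> {}"
  obtains w e where "e \<in> F" "w \<in> e" "\<And>e'. e' \<in> F \<Longrightarrow> w \<in> e' \<Longrightarrow> e' = e"
proof -
  define path where "path vs \<longleftrightarrow> length vs \<ge> 2 \<and> distinct vs \<and>
    (\<forall>k. Suc k < length vs \<longrightarrow> {vs ! k, vs ! Suc k} \<in> F)" for vs :: "'v list"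
  obtain e where "e \<in> F" using nonempty by auto
  then obtain a b where ab: "e = {a, b}" "a \<noteq> b"
    using graph by (auto simp: simple_graph_def card_2_iff)
  then have "path [a, b]"
    using \<open>e \<in> F\<close> by (auto simp: path_def nth_Cons split: nat.splits)
  moreover have "\<forall>vs. path vs \<longrightarrow> length vs < Suc CARD('v)"
    by (metis card_mono distinct_card finite_UNIV le_imp_less_Suc path_def subset_UNIV finite_class.finite_UNIV)
  ultimately obtain vs where vs: "path vs" and longest: "\<And>us. path us \<Longrightarrow> length us \<le> length vs"
    using ex_has_greatest_nat[of path _ length] by blast
  let ?e = "{vs ! 0, vs ! 1}"
  show ?thesis
  proof
    show "?e \<in> F" "vs ! 0 \<in> ?e" using vs by (auto simp: path_def)
    fix e' assume e': "e' \<in> F" "vs ! 0 \<in> e'"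
    then obtain z where z: "e' = {vs ! 0, z}" "z \<noteq> vs ! 0"
      using graph unfolding simple_graph_def card_2_iff by (metis doubleton_eq_iff insert_iff singletonD)
    show "e' = ?e"
    proof (rule ccontr)
      assume ne: "e' \<noteq> ?e"
      show False
      proof (cases "z \<in> set vs")
        case False
        have "path (z # vs)"
          unfolding path_def
        proof (intro conjI allI impI)
          fix k assume "Suc k < length (z # vs)"
          then show "{(z # vs) ! k, (z # vs) ! Suc k} \<in> F"
            using vs e' z by (cases k) (auto simp: path_def insert_commute)
        qed (use False vs in \<open>auto simp: path_def\<close>)
        then show False using longest by fastforce
      next
        case True
        then obtain m where m: "m < length vs" "vs ! m = z" by (auto simp: in_set_conv_nth)
        have "m \<noteq> 0" "m \<noteq> 1" using m z ne by (auto intro!: notI)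
        then have m2: "2 \<le> m" by linarith
        have "is_cycle F (take (Suc m) vs)"
          unfolding is_cycle_def
        proof (intro conjI allI impI)
          show "{last (take (Suc m) vs), hd (take (Suc m) vs)} \<in> F"
            using m e' z by (auto simp: take_Suc_conv_app_nth hd_conv_nth nth_append insert_commute)
        qed (use vs m m2 in \<open>auto simp: path_def\<close>)
        then show False using acyclic by blast
      qed
    qed
  qed
qed

text \<open>
  The block columns of \<open>E_orbit\<close> that belong to the edges of a forest are independent. At a leaf of
  the subgraph on which \<open>q\<close> does not vanish, the block row of the leaf reads
  \<open>\<plusminus>M q k = 0\<close> for the one edge \<open>k\<close> at the leaf, with \<open>M\<close> orthogonal.
\<close>

lemma forest_incidence_injective:
  fixes A :: "('v::finite \<times> 'v) set" and q :: "'v \<times> 'v \<Rightarrow> real^'d"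
  assumes graph: "simple_graph {{u, v} |u v. (u, v) \<in> A}"
    and oriented: "\<And>u v. (u, v) \<in> A \<Longrightarrow> (v, u) \<notin> A"
    and acyclic: "\<nexists>vs. is_cycle {{u, v} |u v. (u, v) \<in> A} vs"
    and orthogonal: "\<And>u v. (u, v) \<in> A \<Longrightarrow> orthogonal_matrix (\<tau> (gamma_between \<Gamma> u v))"
    and kernel: "\<And>w. (\<Sum>k\<in>A. E_orbit \<Gamma> \<tau> w k *v q k) = 0"
    and k: "k \<in> A"
  shows "q k = 0"
proof (rule ccontr)
  assume "q k \<noteq> 0"
  define B where "B = {k \<in> A. q k \<noteq> 0}"
  define F where "F = {{u, v} |u v. (u, v) \<in> B}"
  have sub: "F \<subseteq> {{u, v} |u v. (u, v) \<in> A}" by (auto simp: F_def B_def)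
  have "k \<in> B" using k \<open>q k \<noteq> 0\<close> by (simp add: B_def)
  then have "F \<noteq> {}" by (cases k) (auto simp: F_def)
  moreover have "simple_graph F" using graph sub unfolding simple_graph_def by blast
  moreover have "\<nexists>vs. is_cycle F vs"
    using acyclic is_cycle_mono[OF _ sub] by blast
  ultimately obtain w e where e: "e \<in> F" "w \<in> e" and leaf: "\<And>e'. e' \<in> F \<Longrightarrow> w \<in> e' \<Longrightarrow> e' = e"
    using forest_has_leaf by metis
  obtain u v where uv: "e = {u, v}" "(u, v) \<in> B" using e by (auto simp: F_def)
  have ne: "u \<noteq> v" using uv oriented B_def by blast
  have others: "E_orbit \<Gamma> \<tau> w k *v q k = 0" if "k \<in> A - {(u, v)}" for k
  proof (cases "q k = 0")
    case False
    obtain x y where k: "k = (x, y)" by (cases k)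
    have "w \<noteq> x \<and> w \<noteq> y"
    proof (rule ccontr)
      assume "\<not> ?thesis"
      then have "{x, y} = {u, v}" using leaf[of "{x, y}"] that False k uv by (auto simp: F_def B_def)
      then show False using that k uv oriented by (auto simp: doubleton_eq_iff B_def)
    qed
    then show ?thesis using k by simp
  qed simp
  have "E_orbit \<Gamma> \<tau> w (u, v) *v q (u, v) = (\<Sum>k\<in>A. E_orbit \<Gamma> \<tau> w k *v q k)"
    using others uv by (subst sum.remove[of A "(u, v)"]) (auto simp: B_def)
  then have "E_orbit \<Gamma> \<tau> w (u, v) *v q (u, v) = 0" using kernel by simp
  moreover have "orthogonal_matrix (\<tau> (gamma_between \<Gamma> u v))"
    using orthogonal uv by (auto simp: B_def)
  then have "\<tau> (gamma_between \<Gamma> u v) *v y = 0 \<longleftrightarrow> y = 0" for y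
    by (metis orthogonal_matrix_def matrix_vector_mul_assoc matrix_vector_mul_lid matrix_vector_mult_0_right)
  moreover have "(- M) *v y = - (M *v y)" for M :: "real^'d^'d" and y
    using matrix_vector_mult_diff_rdistrib[of 0 M y] by simp
  ultimately have "q (u, v) = 0"
    using e uv ne by (auto split: if_splits)
  then show False using uv by (simp add: B_def)
qed

section \<open>Free orthogonal group actions\<close>

(* Transposed matrices are kept as matrices acting from the left, and the case distinction between
   loops and other edges in orbit_rigidity is replaced by orbit_rigidity_eq below. *)
declare transpose_matrix_vector [simp del] orbit_rigidity.simps [simp del]

lemma inner_transpose_mult: "(transpose A *v x) \<bullet> y = x \<bullet> (A *v y)"
  for A :: "real^'n^'m"
  by (simp add: transpose_matrix_vector dot_lmul_matrix)

lemma matrix_inv_orthogonal: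
  fixes A :: "real^'n^'n"
  assumes "orthogonal_matrix A"
  shows "matrix_inv A = transpose A"
proof -
  have "A ** matrix_inv A = mat 1 \<and> matrix_inv A ** A = mat 1"
    unfolding matrix_inv_def
    by (rule someI[of _ "transpose A"]) (use assms in \<open>auto simp: orthogonal_matrix_def\<close>)
  with assms show ?thesis
    unfolding orthogonal_matrix_def by (metis matrix_mul_assoc matrix_mul_lid matrix_mul_rid)
qed

lemma group_aut_group: "group (aut_group E)"
proof (rule groupI)
  fix \<gamma> assume g: "\<gamma> \<in> carrier (aut_group E)"
  then have b: "bij \<gamma>" by (simp add: aut_group_def)
  have preserves: "{\<gamma> i, \<gamma> j} \<in> E \<longleftrightarrow> {i, j} \<in> E" for i j
    using g by (simp add: aut_group_def)
  from b have s: "\<gamma> (inv_into UNIV \<gamma> i) = i" for i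
    by (simp add: bij_is_surj surj_f_inv_f)
  have "{inv_into UNIV \<gamma> i, inv_into UNIV \<gamma> j} \<in> E \<longleftrightarrow> {i, j} \<in> E" for i j
    using preserves[of "inv_into UNIV \<gamma> i" "inv_into UNIV \<gamma> j"] by (simp add: s)
  moreover have "inv_into UNIV \<gamma> \<circ> \<gamma> = id"
    using b by (simp add: bij_is_inj)
  ultimately show "\<exists>\<delta>\<in>carrier (aut_group E). \<delta> \<otimes>\<^bsub>aut_group E\<^esub> \<gamma> = \<one>\<^bsub>aut_group E\<^esub>"
    using b bij_imp_bij_inv[OF b]
    by (intro bexI[of _ "inv_into UNIV \<gamma>"]) (auto simp: aut_group_def)
qed (auto simp: aut_group_def bij_comp)

text \<open>
  What the argument uses of a symmetric framework with free symmetry, with the group axioms for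
  \<open>\<Gamma>\<close> unfolded to statements about composition of maps.
\<close>

locale free_orthogonal_action =
  fixes \<Gamma> :: "('v::finite \<Rightarrow> 'v) set"
    and \<tau> :: "('v \<Rightarrow> 'v) \<Rightarrow> real^'d^'d"
    and V0 :: "'v set"
  assumes id_mem: "id \<in> \<Gamma>"
    and comp_mem: "\<And>\<gamma> \<delta>. \<gamma> \<in> \<Gamma> \<Longrightarrow> \<delta> \<in> \<Gamma> \<Longrightarrow> \<gamma> \<circ> \<delta> \<in> \<Gamma>"
    and inverse_ex: "\<And>\<gamma>. \<gamma> \<in> \<Gamma> \<Longrightarrow> \<exists>\<delta>\<in>\<Gamma>. \<delta> \<circ> \<gamma> = id \<and> \<gamma> \<circ> \<delta> = id"
    and free: "free_symmetry \<Gamma>"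
    and orthogonal: "\<And>\<gamma>. \<gamma> \<in> \<Gamma> \<Longrightarrow> orthogonal_matrix (\<tau> \<gamma>)"
    and \<tau>_comp: "\<And>\<gamma> \<delta>. \<gamma> \<in> \<Gamma> \<Longrightarrow> \<delta> \<in> \<Gamma> \<Longrightarrow> \<tau> (\<gamma> \<circ> \<delta>) = \<tau> \<gamma> ** \<tau> \<delta>"
    and representatives: "vertex_representatives \<Gamma> V0"

lemma free_orthogonal_actionI:
  fixes \<tau> :: "('v::finite \<Rightarrow> 'v) \<Rightarrow> real^'d^'d"
  assumes sub: "subgroup \<Gamma> (aut_group E)"
    and hom: "\<tau> \<in> hom (aut_group E\<lparr>carrier := \<Gamma>\<rparr>) orthogonal_group"
    and free: "free_symmetry \<Gamma>"
    and reps: "vertex_representatives \<Gamma> V0"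
  shows "free_orthogonal_action \<Gamma> \<tau> V0"
proof
  interpret group "aut_group E" by (rule group_aut_group)
  show "id \<in> \<Gamma>" using subgroup.one_closed[OF sub] by (simp add: aut_group_def)
  show "\<gamma> \<circ> \<delta> \<in> \<Gamma>" if "\<gamma> \<in> \<Gamma>" "\<delta> \<in> \<Gamma>" for \<gamma> \<delta>
    using subgroup.m_closed[OF sub that] by (simp add: aut_group_def)
  show "\<exists>\<delta>\<in>\<Gamma>. \<delta> \<circ> \<gamma> = id \<and> \<gamma> \<circ> \<delta> = id" if g: "\<gamma> \<in> \<Gamma>" for \<gamma>
  proof -
    have c: "\<gamma> \<in> carrier (aut_group E)" using subgroup.mem_carrier[OF sub g] .
    show ?thesis
      using subgroup.m_inv_closed[OF sub g] l_inv[OF c] r_inv[OF c]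
      by (intro bexI[of _ "m_inv (aut_group E) \<gamma>"]) (auto simp: aut_group_def)
  qed
  show "free_symmetry \<Gamma>" "vertex_representatives \<Gamma> V0" by fact+
  show "orthogonal_matrix (\<tau> \<gamma>)" if "\<gamma> \<in> \<Gamma>" for \<gamma>
    using hom that by (auto simp: hom_def orthogonal_group_def)
  show "\<tau> (\<gamma> \<circ> \<delta>) = \<tau> \<gamma> ** \<tau> \<delta>" if "\<gamma> \<in> \<Gamma>" "\<delta> \<in> \<Gamma>" for \<gamma> \<delta>
    using hom that by (auto simp: hom_def orthogonal_group_def aut_group_def)
qed

context free_orthogonal_action
begin

lemma agree_at_vertex:
  assumes "\<gamma> \<in> \<Gamma>" "\<delta> \<in> \<Gamma>" "\<gamma> u = \<delta> u"
  shows "\<gamma> = \<delta>"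
proof -
  obtain \<eta> where \<eta>: "\<eta> \<in> \<Gamma>" "\<eta> \<circ> \<delta> = id" "\<delta> \<circ> \<eta> = id" using inverse_ex assms by metis
  have "(\<eta> \<circ> \<gamma>) u = u" using assms \<eta> by (simp add: fun_eq_iff)
  then have "\<eta> \<circ> \<gamma> = id"
    using comp_mem[OF \<eta>(1) assms(1)] free unfolding free_symmetry_def by blast
  then have "\<delta> \<circ> (\<eta> \<circ> \<gamma>) = \<delta>" by simp
  then show ?thesis using \<eta> by (simp flip: comp_assoc)
qed

lemma gamma_between_eq: "\<gamma> \<in> \<Gamma> \<Longrightarrow> gamma_between \<Gamma> u (\<gamma> u) = \<gamma>"
  unfolding gamma_between_def by (rule the_equality) (auto dest: agree_at_vertex)

lemma \<tau>_id: "\<tau> id = mat 1"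
proof -
  have "\<tau> id ** \<tau> id = \<tau> id" using \<tau>_comp[OF id_mem id_mem] by simp
  then show ?thesis
    using orthogonal[OF id_mem] unfolding orthogonal_matrix_def
    by (metis matrix_mul_assoc matrix_mul_rid)
qed

lemma \<tau>_inverse:
  assumes "\<gamma> \<in> \<Gamma>" "\<delta> \<in> \<Gamma>" "\<delta> \<circ> \<gamma> = id"
  shows "\<tau> \<delta> = transpose (\<tau> \<gamma>)"
proof -
  have "\<tau> \<delta> ** \<tau> \<gamma> = mat 1" using \<tau>_comp[of \<delta> \<gamma>] assms \<tau>_id by simp
  then show ?thesis
    using orthogonal[OF assms(1)] unfolding orthogonal_matrix_def
    by (metis matrix_mul_assoc matrix_mul_rid matrix_mul_lid)
qed

lemma \<tau>_cancel [simp]: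
  assumes "\<gamma> \<in> \<Gamma>"
  shows "transpose (\<tau> \<gamma>) *v (\<tau> \<gamma> *v x) = x" "\<tau> \<gamma> *v (transpose (\<tau> \<gamma>) *v x) = x"
  using orthogonal[OF assms] by (simp_all add: orthogonal_matrix_def matrix_vector_mul_assoc)

lemma vertex_normal_form:
  obtains i \<gamma> where "i \<in> V0" "\<gamma> \<in> \<Gamma>" "w = \<gamma> i"
  using representatives unfolding vertex_representatives_def vertex_orbit_def by blast

text \<open>
  Together with \<open>vertex_normal_form\<close>: the map \<open>(i, \<gamma>) \<mapsto> \<gamma> i\<close> is a bijection from
  \<open>V0 \<times> \<Gamma>\<close> onto the vertices. All sums over orbits are evaluated in these coordinates.
\<close>

lemma normal_form_unique:
  assumes "i \<in> V0" "j \<in> V0" "\<gamma> \<in> \<Gamma>" "\<delta> \<in> \<Gamma>" "\<gamma> i = \<delta> j"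
  shows "i = j" "\<gamma> = \<delta>"
proof -
  have "\<gamma> i \<in> vertex_orbit \<Gamma> i" "\<gamma> i \<in> vertex_orbit \<Gamma> j"
    using assms(3,4) by (auto simp: vertex_orbit_def assms(5)) (auto simp: assms(5)[symmetric])
  then show "i = j"
    using representatives assms unfolding vertex_representatives_def by blast
  then show "\<gamma> = \<delta>" using assms agree_at_vertex by blast
qed

lemma orbit_transporter:
  assumes "u \<in> vertex_orbit \<Gamma> i" "v \<in> vertex_orbit \<Gamma> i"
  obtains \<gamma> where "\<gamma> \<in> \<Gamma>" "v = \<gamma> u"
proof -
  obtain \<alpha> \<beta> where ab: "\<alpha> \<in> \<Gamma>" "u = \<alpha> i" "\<beta> \<in> \<Gamma>" "v = \<beta> i"
    using assms by (auto simp: vertex_orbit_def)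
  obtain \<eta> where \<eta>: "\<eta> \<in> \<Gamma>" "\<eta> \<circ> \<alpha> = id" using inverse_ex ab by metis
  have "(\<beta> \<circ> \<eta>) u = v" using ab \<eta> by (simp add: pointfree_idE)
  then show thesis using that comp_mem ab \<eta> by metis
qed

text \<open>
  Symmetric vectors are determined by arbitrary values on \<open>V0\<close>, transported by
  \<open>y (\<gamma> i) = \<tau> \<gamma> z i\<close>; freeness makes this well defined.
\<close>

lemma symmetric_extension:
  obtains y :: "(real^'d)^'v"
  where "symmetric_vectors \<Gamma> \<tau> y" "\<And>i. i \<in> V0 \<Longrightarrow> y $ i = z i"
proof -
  have "\<exists>x. \<forall>i\<in>V0. \<forall>\<gamma>\<in>\<Gamma>. w = \<gamma> i \<longrightarrow> x = \<tau> \<gamma> *v z i" for w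
  proof -
    obtain i \<gamma> where "i \<in> V0" "\<gamma> \<in> \<Gamma>" "w = \<gamma> i" by (rule vertex_normal_form)
    then show ?thesis using normal_form_unique by metis
  qed
  then obtain f where f: "\<And>i \<gamma>. i \<in> V0 \<Longrightarrow> \<gamma> \<in> \<Gamma> \<Longrightarrow> f (\<gamma> i) = \<tau> \<gamma> *v z i"
    by metis
  show thesis
  proof
    show "symmetric_vectors \<Gamma> \<tau> (\<chi> w. f w)"
      unfolding symmetric_vectors_def
    proof (intro ballI allI)
      fix \<delta> w assume d: "\<delta> \<in> \<Gamma>"
      obtain i \<gamma> where w: "i \<in> V0" "\<gamma> \<in> \<Gamma>" "w = \<gamma> i" by (rule vertex_normal_form)
      show "\<tau> \<delta> *v (\<chi> w. f w) $ w = (\<chi> w. f w) $ \<delta> w"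
        using f[OF w(1) comp_mem[OF d w(2)]] f[OF w(1,2)] w \<tau>_comp[OF d w(2)]
        by (simp add: matrix_vector_mul_assoc)
    qed
    show "(\<chi> w. f w) $ i = z i" if "i \<in> V0" for i
      using f[OF that id_mem] \<tau>_id by simp
  qed
qed

end

section \<open>The orbit rigidity matrix and symmetric self-stresses\<close>

lemma if_mult_vector: "(if b then A else B) *v x = (if b then A *v x else B *v x)"
  by simp

lemma stacked_Inl: "stacked p (Inl i) = p $ i" and stacked_Inr: "stacked p (Inr i) = p $ i"
  by (auto simp: stacked_def bapply_def Pmat_def if_mult_vector cong: if_cong)

lemma p0_part_eq: "p0_part p = ($) p"
  by (simp add: p0_part_def stacked_Inl fun_eq_iff)

context free_orthogonal_action
begin

text \<open>
  A gain edge contributes one term for each of its two ends; for a loop both terms fall on the same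
  vertex. In this form loops are no special case.
\<close>

lemma orbit_rigidity_eq:
  assumes "\<gamma> \<in> \<Gamma>"
  shows "orbit_rigidity \<tau> x (a, b, \<gamma>) k =
    (if k = a then x a - \<tau> \<gamma> *v x b else 0) + (if k = b then x b - transpose (\<tau> \<gamma>) *v x a else 0)"
  using matrix_inv_orthogonal[OF orthogonal[OF assms]]
  by (auto simp: orbit_rigidity.simps scaleR_2 algebra_simps)

text \<open>
  The row of a gain edge is half the differential of the squared length
  \<open>\<bar>x a - \<tau> \<gamma> x b\<bar>\<^sup>2\<close>; at \<open>y = x\<close> it is that squared length itself.
\<close>

lemma rigidity_apply_eq:
  assumes "a \<in> V0" "b \<in> V0" "\<gamma> \<in> \<Gamma>"
  shows "rigidity_apply V0 \<tau> x y (a, b, \<gamma>) = (x a - \<tau> \<gamma> *v x b) \<bullet> (y a - \<tau> \<gamma> *v y b)"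
proof -
  have "rigidity_apply V0 \<tau> x y (a, b, \<gamma>) =
      (\<Sum>k\<in>V0. (if k = a then (x a - \<tau> \<gamma> *v x b) \<bullet> y k else 0)) +
      (\<Sum>k\<in>V0. (if k = b then (x b - transpose (\<tau> \<gamma>) *v x a) \<bullet> y k else 0))"
    unfolding rigidity_apply_def orbit_rigidity_eq[OF assms(3)] sum.distrib[symmetric]
    by (intro sum.cong) (auto simp: inner_add_left)
  also have "\<dots> = (x a - \<tau> \<gamma> *v x b) \<bullet> y a + (x b - transpose (\<tau> \<gamma>) *v x a) \<bullet> y b"
    using assms by simp
  also have "x b - transpose (\<tau> \<gamma>) *v x a = - (transpose (\<tau> \<gamma>) *v (x a - \<tau> \<gamma> *v x b))"
    using assms by (simp add: algebra_simps)
  also have "\<dots> \<bullet> y b = - ((x a - \<tau> \<gamma> *v x b) \<bullet> (\<tau> \<gamma> *v y b))"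
    by (simp only: inner_minus_left inner_transpose_mult)
  finally show ?thesis by (simp add: inner_diff_right)
qed

text \<open>
  A row dependence \<open>s\<close> of the orbit rigidity matrix spreads over the group to a symmetric
  self-stress \<open>\<omega>\<close>. The value \<open>\<omega> e\<close> adds up \<open>s g\<close> over all pairs \<open>(g, \<delta>)\<close> for which
  \<open>\<delta>\<close> maps the representative of \<open>g\<close> to \<open>e\<close>. Counting group elements rather than edges gives
  an edge that is inverted by a group element the weight 2 by itself, matching the factor 2 in
  the row of the corresponding loop. The equilibrium condition of \<open>\<omega>\<close> at the vertex \<open>\<eta> i\<close>
  is then \<open>\<tau> \<eta>\<close> applied to the column condition of \<open>s\<close> at \<open>i\<close>.
\<close>

lemma orbit_stress_trivial:
  assumes graph: "simple_graph E"
    and invariant: "\<And>\<gamma> e. \<gamma> \<in> \<Gamma> \<Longrightarrow> e \<in> E \<Longrightarrow> \<gamma> ` e \<in> E"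
    and edges: "edge_representatives E \<Gamma> V0 E0"
    and sym: "symmetric_vectors \<Gamma> \<tau> p"
    and no_stress: "\<And>\<omega>. self_stress E p \<omega> \<Longrightarrow> symmetric_stress E \<Gamma> \<omega> \<Longrightarrow> \<forall>e\<in>E. \<omega> e = 0"
    and kernel: "\<And>i. i \<in> V0 \<Longrightarrow> rigidity_transpose_apply E0 \<tau> (($) p) s i = 0"
    and g: "g \<in> E0"
  shows "s g = 0"
proof -
  define \<omega> where "\<omega> e = (\<Sum>g\<in>E0. \<Sum>\<delta>\<in>\<Gamma>. if \<delta> ` edge_of_gain g = e then s g else 0)" for e
  have E0: "a \<in> V0" "b \<in> V0" "\<gamma> \<in> \<Gamma>" "edge_of_gain (a, b, \<gamma>) \<in> E" if "(a, b, \<gamma>) \<in> E0" for a b \<gamma>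
    using edges that unfolding edge_representatives_def by auto
  have symP: "p $ (\<gamma> v) = \<tau> \<gamma> *v p $ v" if "\<gamma> \<in> \<Gamma>" for \<gamma> v
    using sym that by (simp add: symmetric_vectors_def)
  have "symmetric_stress E \<Gamma> \<omega>"
    unfolding symmetric_stress_def
  proof (intro ballI)
    fix \<gamma> e assume c: "\<gamma> \<in> \<Gamma>"
    obtain \<eta> where \<eta>: "\<eta> \<in> \<Gamma>" "\<eta> \<circ> \<gamma> = id" "\<gamma> \<circ> \<eta> = id" using inverse_ex c by metis
    have img: "\<gamma> ` A = \<gamma> ` B \<longleftrightarrow> A = B" for A B
      using \<eta>(2) by (metis image_comp image_id id_apply)
    have "(\<Sum>\<delta>\<in>\<Gamma>. if \<delta> ` edge_of_gain g = \<gamma> ` e then s g else 0)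
        = (\<Sum>\<delta>\<in>\<Gamma>. if \<delta> ` edge_of_gain g = e then s g else 0)" for g
    proof (rule sum.reindex_bij_witness[where i = "\<lambda>\<delta>. \<gamma> \<circ> \<delta>" and j = "\<lambda>\<delta>. \<eta> \<circ> \<delta>"])
      fix \<delta> assume d: "\<delta> \<in> \<Gamma>"
      show "\<gamma> \<circ> (\<eta> \<circ> \<delta>) = \<delta>" "\<eta> \<circ> (\<gamma> \<circ> \<delta>) = \<delta>"
        using \<eta> by (simp_all flip: comp_assoc)
      show "\<eta> \<circ> \<delta> \<in> \<Gamma>" "\<gamma> \<circ> \<delta> \<in> \<Gamma>" using comp_mem c d \<eta> by auto
      have "\<delta> ` edge_of_gain g = \<gamma> ` (\<eta> \<circ> \<delta>) ` edge_of_gain g"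
        using \<open>\<gamma> \<circ> (\<eta> \<circ> \<delta>) = \<delta>\<close> by (metis image_comp)
      then show "(if (\<eta> \<circ> \<delta>) ` edge_of_gain g = e then s g else 0) =
          (if \<delta> ` edge_of_gain g = \<gamma> ` e then s g else 0)"
        by (simp add: img)
    qed
    then show "\<omega> (\<gamma> ` e) = \<omega> e" by (simp add: \<omega>_def)
  qed
  moreover have "self_stress E p \<omega>"
    unfolding self_stress_def
  proof
    fix w
    obtain i \<eta> where w: "i \<in> V0" "\<eta> \<in> \<Gamma>" "w = \<eta> i" by (rule vertex_normal_form)
    have orbit_sum: "(\<Sum>\<delta>\<in>\<Gamma>. \<Sum>j | {w, j} \<in> E.
          (if \<delta> ` edge_of_gain g = {w, j} then s g else 0) *\<^sub>R (p $ w - p $ j))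
        = \<tau> \<eta> *v (s g *\<^sub>R orbit_rigidity \<tau> (($) p) g i)" if g: "g \<in> E0" for g
    proof -
      obtain a b \<gamma> where abc: "g = (a, b, \<gamma>)" by (cases g)
      note E0' = E0[OF g[unfolded abc]]
      obtain \<beta> where \<beta>: "\<beta> \<in> \<Gamma>" "\<beta> \<circ> \<gamma> = id" "\<gamma> \<circ> \<beta> = id" using inverse_ex E0' by metis
      have ne: "\<delta> a \<noteq> \<delta> (\<gamma> b)" "{\<delta> a, \<delta> (\<gamma> b)} \<in> E" if "\<delta> \<in> \<Gamma>" for \<delta>
      proof -
        show "{\<delta> a, \<delta> (\<gamma> b)} \<in> E"
          using invariant[OF that E0'(4)] by (simp add: edge_of_gain_def)
        then show "\<delta> a \<noteq> \<delta> (\<gamma> b)" using graph by (force simp: simple_graph_def)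
      qed
      have inner: "(\<Sum>j | {w, j} \<in> E. (if \<delta> ` edge_of_gain g = {w, j} then s g else 0) *\<^sub>R (p $ w - p $ j))
          = (if \<delta> a = w then s g *\<^sub>R (p $ w - p $ (\<delta> (\<gamma> b))) else 0)
          + (if \<delta> (\<gamma> b) = w then s g *\<^sub>R (p $ w - p $ (\<delta> a)) else 0)"
        if d: "\<delta> \<in> \<Gamma>" for \<delta>
      proof -
        have "(\<Sum>j | {w, j} \<in> E. (if \<delta> ` edge_of_gain g = {w, j} then s g else 0) *\<^sub>R (p $ w - p $ j))
            = (\<Sum>j\<in>UNIV. (if j = \<delta> (\<gamma> b) then (if \<delta> a = w then s g *\<^sub>R (p $ w - p $ j) else 0) else 0)
               + (if j = \<delta> a then (if \<delta> (\<gamma> b) = w then s g *\<^sub>R (p $ w - p $ j) else 0) else 0))"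
          using ne[OF d]
          by (intro sum.mono_neutral_cong_left)
            (auto simp: abc edge_of_gain_def doubleton_eq_iff insert_commute)
        then show ?thesis by (simp add: sum.distrib)
      qed
      \<comment> \<open>Freeness: for each end of \<open>g\<close>, at most one group element moves it to \<open>w = \<eta> i\<close>.\<close>
      have at_a: "\<delta> a = w \<longleftrightarrow> a = i \<and> \<delta> = \<eta>" if "\<delta> \<in> \<Gamma>" for \<delta>
        using normal_form_unique[OF E0'(1) w(1) that w(2)] w by auto
      have at_b: "\<delta> (\<gamma> b) = w \<longleftrightarrow> b = i \<and> \<delta> = \<eta> \<circ> \<beta>" if "\<delta> \<in> \<Gamma>" for \<delta>
      proof
        assume "\<delta> (\<gamma> b) = w"
        then have "b = i \<and> \<delta> \<circ> \<gamma> = \<eta>"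
          using normal_form_unique[OF E0'(2) w(1) comp_mem[OF that E0'(3)] w(2)] w by auto
        moreover have "\<delta> \<circ> \<gamma> \<circ> \<beta> = \<delta>" using \<beta> by (simp add: comp_assoc)
        ultimately show "b = i \<and> \<delta> = \<eta> \<circ> \<beta>" by auto
      next
        assume "b = i \<and> \<delta> = \<eta> \<circ> \<beta>"
        then show "\<delta> (\<gamma> b) = w" using \<beta> w by (simp add: pointfree_idE)
      qed
      have mem: "\<eta> \<circ> \<beta> \<in> \<Gamma>" using comp_mem w \<beta> by blast
      have "(\<Sum>\<delta>\<in>\<Gamma>. \<Sum>j | {w, j} \<in> E.
            (if \<delta> ` edge_of_gain g = {w, j} then s g else 0) *\<^sub>R (p $ w - p $ j))
          = (\<Sum>\<delta>\<in>\<Gamma>. (if \<delta> = \<eta> then (if a = i then s g *\<^sub>R (p $ w - p $ (\<delta> (\<gamma> b))) else 0) else 0)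
            + (if \<delta> = \<eta> \<circ> \<beta> then (if b = i then s g *\<^sub>R (p $ w - p $ (\<delta> a)) else 0) else 0))"
        by (intro sum.cong refl) (auto simp: inner at_a at_b)
      also have "\<dots> = (if a = i then s g *\<^sub>R (p $ w - p $ (\<eta> (\<gamma> b))) else 0)
            + (if b = i then s g *\<^sub>R (p $ w - p $ (\<eta> (\<beta> a))) else 0)"
        using w mem by (simp add: sum.distrib)
      also have "\<dots> = \<tau> \<eta> *v (s g *\<^sub>R orbit_rigidity \<tau> (($) p) g i)"
        using w(2,3) \<beta> E0'(3)
        by (simp add: abc orbit_rigidity_eq symP \<tau>_inverse[OF E0'(3) \<beta>(1,2)] algebra_simps)
      finally show ?thesis .
    qed
    have "(\<Sum>j | {w, j} \<in> E. \<omega> {w, j} *\<^sub>R (p $ w - p $ j))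
        = (\<Sum>j | {w, j} \<in> E. \<Sum>g\<in>E0. \<Sum>\<delta>\<in>\<Gamma>.
            (if \<delta> ` edge_of_gain g = {w, j} then s g else 0) *\<^sub>R (p $ w - p $ j))"
      by (simp add: \<omega>_def scaleR_sum_left)
    also have "\<dots> = (\<Sum>g\<in>E0. \<Sum>j | {w, j} \<in> E. \<Sum>\<delta>\<in>\<Gamma>.
            (if \<delta> ` edge_of_gain g = {w, j} then s g else 0) *\<^sub>R (p $ w - p $ j))"
      by (rule sum.swap)
    also have "\<dots> = (\<Sum>g\<in>E0. \<Sum>\<delta>\<in>\<Gamma>. \<Sum>j | {w, j} \<in> E.
            (if \<delta> ` edge_of_gain g = {w, j} then s g else 0) *\<^sub>R (p $ w - p $ j))"
      by (intro sum.cong refl sum.swap)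
    also have "\<dots> = (\<Sum>g\<in>E0. \<tau> \<eta> *v (s g *\<^sub>R orbit_rigidity \<tau> (($) p) g i))"
      by (intro sum.cong refl orbit_sum)
    also have "\<dots> = \<tau> \<eta> *v rigidity_transpose_apply E0 \<tau> (($) p) s i"
      unfolding rigidity_transpose_apply_def by (rule linear_sum[symmetric]) simp
    finally show "(\<Sum>j | {w, j} \<in> E. \<omega> {w, j} *\<^sub>R (p $ w - p $ j)) = 0"
      using kernel[OF w(1)] by simp
  qed
  ultimately have zero: "\<forall>e\<in>E. \<omega> e = 0" using no_stress by blast
  \<comment> \<open>Only \<open>g\<close> itself contributes to \<open>\<omega>\<close> at its representative, once for each element of the nonempty stabiliser \<open>?S\<close>.\<close>
  let ?e = "edge_of_gain g" and ?S = "{\<delta> \<in> \<Gamma>. \<delta> ` edge_of_gain g = edge_of_gain g}"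
  have eE: "?e \<in> E" using g edges unfolding edge_representatives_def by blast
  have only: "h = g" if "h \<in> E0" "\<delta> \<in> \<Gamma>" "\<delta> ` edge_of_gain h = ?e" for h \<delta>
  proof -
    have "?e \<in> edge_orbit \<Gamma> (edge_of_gain h)" using that by (auto simp: edge_orbit_def)
    moreover have "?e \<in> edge_orbit \<Gamma> ?e" unfolding edge_orbit_def by (intro CollectI exI[of _ id]) (simp add: id_mem)
    ultimately show ?thesis using edges eE g that(1) unfolding edge_representatives_def by blast
  qed
  have "\<omega> ?e = (\<Sum>\<delta>\<in>\<Gamma>. if \<delta> ` ?e = ?e then s g else 0)"
    unfolding \<omega>_def
    by (subst sum.remove[OF _ g]) (auto intro!: sum.neutral dest: only)
  also have "\<dots> = real (card ?S) * s g"
    by (simp flip: sum.inter_filter)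
  finally have "real (card ?S) = 0 \<or> s g = 0"
    using zero[rule_format, OF eE] by (metis mult_eq_0_iff)
  moreover have "card ?S > 0"
    using id_mem by (subst card_gt_0_iff) (auto intro: exI[of _ id])
  ultimately show ?thesis by linarith
qed

end

section \<open>The closed loop and the error map\<close>

lemma sum_matrix_vector_mult: "(\<Sum>k\<in>K. A k) *v x = (\<Sum>k\<in>K. A k *v x)"
  for A :: "'k \<Rightarrow> real^'n^'m"
  by (induction K rule: infinite_finite_induct) (auto simp: algebra_simps)

lemma matrix_vector_mult_sum: "A *v (\<Sum>k\<in>K. x k) = (\<Sum>k\<in>K. A *v x k)"
  for A :: "real^'n^'m"
  by (rule linear_sum) simp

lemma bmult_Pmat: "bmult UNIV Pmat A r = A (case_sum id id r)"
  for A :: "('v::finite, 'c, 'd::finite) block_matrix"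
proof -
  have "Pmat r v ** A v c = (if v = case_sum id id r then A v c else 0)" for v c
    by (cases r) (auto simp: Pmat_def)
  then show ?thesis by (simp add: bmult_def fun_eq_iff)
qed

lemma bmult_Pmat_transpose: "bmult UNIV A (btranspose Pmat) r c = A r (case_sum id id c)"
  for A :: "('r, 'v::finite, 'd::finite) block_matrix"
proof -
  have "transpose 0 = (0 :: real^'d^'d)" by (simp add: vec_eq_iff transpose_def)
  then have "A r v ** transpose (Pmat c v) = (if v = case_sum id id c then A r v else 0)" for v
    by (cases c) (auto simp: Pmat_def)
  then show ?thesis by (simp add: bmult_def btranspose_def)
qed

lemma Ebar0_eq: "Ebar0 \<Gamma> \<tau> = Ebar \<Gamma> \<tau>"
  by (simp add: Ebar0_def bmult_Pmat)

text \<open>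
  The permutation only renames indices, and \<open>Q p = Ebar (Ebar\<^sup>T p)\<close>; hence the symmetry-forcing
  term depends on \<open>p\<close> through the error \<open>q_bar\<close> alone.
\<close>

lemma permuted_Q_apply:
  "bapply (stack_index V0) (bmult UNIV (bmult UNIV Pmat (Qmat \<Gamma> \<tau> V0 T)) (btranspose Pmat)) (stacked p) r
    = bapply (tree_columns V0 T) (Ebar \<Gamma> \<tau>) (q_bar \<Gamma> \<tau> p) (case_sum id id r)"
proof -
  define i where "i = case_sum id id r"
  let ?f = "\<lambda>v. Qmat \<Gamma> \<tau> V0 T i v *v p $ v"
  have "bapply (stack_index V0) (bmult UNIV (bmult UNIV Pmat (Qmat \<Gamma> \<tau> V0 T)) (btranspose Pmat)) (stacked p) r
      = (\<Sum>v\<in>V0. ?f v) + (\<Sum>v\<in>- V0. ?f v)"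
    unfolding bapply_def stack_index_def bmult_Pmat_transpose bmult_Pmat i_def
    by (subst sum.Plus) (auto simp: stacked_Inl stacked_Inr)
  also have "\<dots> = (\<Sum>v\<in>UNIV. ?f v)"
    using sum.union_disjoint[of V0 "- V0" ?f] by simp
  also have "\<dots> = (\<Sum>v\<in>UNIV. \<Sum>k\<in>tree_columns V0 T. Ebar \<Gamma> \<tau> i k *v (transpose (Ebar \<Gamma> \<tau> v k) *v p $ v))"
    by (simp add: Qmat_def bmult_def btranspose_def sum_matrix_vector_mult matrix_vector_mul_assoc)
  also have "\<dots> = (\<Sum>k\<in>tree_columns V0 T. \<Sum>v\<in>UNIV. Ebar \<Gamma> \<tau> i k *v (transpose (Ebar \<Gamma> \<tau> v k) *v p $ v))"
    by (rule sum.swap)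
  also have "\<dots> = bapply (tree_columns V0 T) (Ebar \<Gamma> \<tau>) (q_bar \<Gamma> \<tau> p) i"
    by (simp add: bapply_def q_bar_def btranspose_def matrix_vector_mult_sum)
  finally show ?thesis by (simp add: i_def)
qed

text \<open>
  Errors are collected in one Euclidean space, indexed by all conceivable gain edges and tree
  columns, of which only the coordinates in \<open>E0\<close> and \<open>tree_columns V0 T\<close> matter. Elements of
  \<open>error_subspace\<close> vanish in the remaining coordinates, and there the norm is \<open>error_norm\<close>.
\<close>

type_synonym ('v, 'd) error_space = "(real^'v gain_edge) \<times> ((real^'d)^'v tree_column)"

text \<open>
  This is the block matrix with the block columns \<open>(O\<^sup>T, 0)\<close> and \<open>Ebar\<close>, applied to an error
  \<open>(\<sigma>, q)\<close>. It is the transpose of the map \<open>v \<mapsto> (O v, Ebar\<^sup>T v)\<close> from velocities to rates of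
  the errors, up to the factor 2 in the first component.
\<close>

definition dual_force ::
  "('v::finite \<Rightarrow> 'v) set \<Rightarrow> (('v \<Rightarrow> 'v) \<Rightarrow> real^'d^'d) \<Rightarrow> 'v set \<Rightarrow> 'v gain_edge set
     \<Rightarrow> ('v \<Rightarrow> ('v \<times> 'v) set) \<Rightarrow> ('v \<Rightarrow> real^'d) \<Rightarrow> ('v, 'd) error_space \<Rightarrow> (real^'d)^'v" where
  "dual_force \<Gamma> \<tau> V0 E0 T x e = (\<chi> w.
     (if w \<in> V0 then rigidity_transpose_apply E0 \<tau> x (($) (fst e)) w else 0)
     + bapply (tree_columns V0 T) (Ebar \<Gamma> \<tau>) (($) (snd e)) w)"

definition error_vector ::
  "('v::finite \<Rightarrow> 'v) set \<Rightarrow> (('v \<Rightarrow> 'v) \<Rightarrow> real^'d^'d) \<Rightarrow> 'v set \<Rightarrow> 'v gain_edge set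
     \<Rightarrow> ('v \<Rightarrow> ('v \<times> 'v) set) \<Rightarrow> ('v gain_edge \<Rightarrow> real) \<Rightarrow> (real^'d)^'v \<Rightarrow> ('v, 'd) error_space" where
  "error_vector \<Gamma> \<tau> V0 E0 T d2 p =
     (\<chi> g. if g \<in> E0 then sigma_bar \<tau> V0 d2 p g else 0,
      \<chi> k. if k \<in> tree_columns V0 T then q_bar \<Gamma> \<tau> p k else 0)"

definition error_subspace ::
  "'v set \<Rightarrow> 'v gain_edge set \<Rightarrow> ('v \<Rightarrow> ('v \<times> 'v) set) \<Rightarrow> ('v::finite, 'd::finite) error_space set" where
  "error_subspace V0 E0 T =
     {e. (\<forall>g. g \<notin> E0 \<longrightarrow> fst e $ g = 0) \<and> (\<forall>k. k \<notin> tree_columns V0 T \<longrightarrow> snd e $ k = 0)}"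

lemma error_vector_in_subspace: "error_vector \<Gamma> \<tau> V0 E0 T d2 p \<in> error_subspace V0 E0 T"
  by (simp add: error_vector_def error_subspace_def)

lemma norm_error_vector:
  "norm (error_vector \<Gamma> \<tau> V0 E0 T d2 p) = error_norm V0 E0 T (sigma_bar \<tau> V0 d2 p) (q_bar \<Gamma> \<tau> p)"
proof -
  have *: "(\<Sum>x\<in>UNIV. (norm (if x \<in> A then f x else 0))\<^sup>2) = (\<Sum>x\<in>A. (norm (f x))\<^sup>2)"
    for A :: "'x::finite set" and f :: "'x \<Rightarrow> 'y::real_normed_vector"
    by (rule sum.mono_neutral_cong_right) auto
  show ?thesis
    using *[of E0 "sigma_bar \<tau> V0 d2 p"] *[of "tree_columns V0 T" "q_bar \<Gamma> \<tau> p"]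
    by (simp add: error_vector_def error_norm_def norm_prod_def norm_vec_def L2_set_def sum_nonneg)
qed

lemma dual_force_adjoint:
  "dual_force \<Gamma> \<tau> V0 E0 T x e \<bullet> y =
     (\<Sum>g\<in>E0. fst e $ g * rigidity_apply V0 \<tau> x (($) y) g)
     + (\<Sum>k\<in>tree_columns V0 T. snd e $ k \<bullet> q_bar \<Gamma> \<tau> y k)"
proof -
  have "(\<Sum>w\<in>UNIV. (if w \<in> V0 then rigidity_transpose_apply E0 \<tau> x (($) (fst e)) w else 0) \<bullet> y $ w)
      = (\<Sum>w\<in>V0. \<Sum>g\<in>E0. fst e $ g * (orbit_rigidity \<tau> x g w \<bullet> y $ w))"
    by (rule sum.mono_neutral_cong_right)
      (auto simp: rigidity_transpose_apply_def inner_sum_left)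
  also have "\<dots> = (\<Sum>g\<in>E0. fst e $ g * rigidity_apply V0 \<tau> x (($) y) g)"
    by (subst sum.swap) (simp add: rigidity_apply_def sum_distrib_left)
  finally have 1: "(\<Sum>w\<in>UNIV. (if w \<in> V0 then rigidity_transpose_apply E0 \<tau> x (($) (fst e)) w else 0) \<bullet> y $ w)
      = (\<Sum>g\<in>E0. fst e $ g * rigidity_apply V0 \<tau> x (($) y) g)" .
  have "(\<Sum>w\<in>UNIV. bapply (tree_columns V0 T) (Ebar \<Gamma> \<tau>) (($) (snd e)) w \<bullet> y $ w)
      = (\<Sum>w\<in>UNIV. \<Sum>k\<in>tree_columns V0 T. snd e $ k \<bullet> (transpose (Ebar \<Gamma> \<tau> w k) *v y $ w))"
    unfolding bapply_def inner_sum_left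
    by (intro sum.cong refl) (metis inner_transpose_mult transpose_transpose)
  also have "\<dots> = (\<Sum>k\<in>tree_columns V0 T. snd e $ k \<bullet> q_bar \<Gamma> \<tau> y k)"
    by (subst sum.swap) (simp add: q_bar_def bapply_def btranspose_def inner_sum_right)
  finally show ?thesis
    using 1 by (simp add: dual_force_def inner_vec_def[of "vec_lambda _"] inner_add_left sum.distrib)
qed

lemma has_vector_derivative_vecI:
  fixes p :: "real \<Rightarrow> 'a::euclidean_space^'n"
  assumes "\<And>i. ((\<lambda>s. p s $ i) has_vector_derivative p' $ i) F"
  shows "(p has_vector_derivative p') F"
proof -
  have expand: "(\<Sum>i\<in>UNIV. axis i (z $ i)) = z" for z :: "'a^'n"
    by (simp add: vec_eq_iff axis_def if_distrib cong: if_cong)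
  have axis: "bounded_linear (axis i :: 'a \<Rightarrow> 'a^'n)" for i
    by (intro linear_conv_bounded_linear[THEN iffD1] linearI) (auto simp: axis_def vec_eq_iff)
  have "((\<lambda>s. axis i (p s $ i)) has_vector_derivative axis i (p' $ i)) F" for i
    by (rule bounded_linear.has_vector_derivative[OF axis assms])
  then have "((\<lambda>s. \<Sum>i\<in>UNIV. axis i (p s $ i)) has_vector_derivative (\<Sum>i\<in>UNIV. axis i (p' $ i))) F"
    by (rule has_vector_derivative_sum)
  then show ?thesis by (simp add: expand)
qed

text \<open>
  Both feedback terms, \<open>O\<^sup>T \<sigma>\<close> and \<open>Q p = Ebar q\<close>, are images of the current error under the
  transposed error map. This is what makes the system dissipative.
\<close>

lemma closed_loop_derivative:
  assumes sol: "closed_loop_solution \<Gamma> \<tau> V0 E0 T d2 J p" and t: "t \<in> J"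
  shows "(p has_vector_derivative
      - dual_force \<Gamma> \<tau> V0 E0 T (($) (p t)) (error_vector \<Gamma> \<tau> V0 E0 T d2 (p t))) (at t within J)"
proof (rule has_vector_derivative_vecI)
  fix i
  define r where "r = (if i \<in> V0 then Inl i else Inr i)"
  have r: "r \<in> stack_index V0" by (auto simp: r_def stack_index_def)
  have ri: "case_sum id id r = i" by (simp add: r_def)
  have "closed_loop_rhs \<Gamma> \<tau> V0 E0 T d2 (p t) r
      = - dual_force \<Gamma> \<tau> V0 E0 T (($) (p t)) (error_vector \<Gamma> \<tau> V0 E0 T d2 (p t)) $ i"
    unfolding closed_loop_rhs_def permuted_Q_apply ri
    by (simp add: dual_force_def error_vector_def r_def p0_part_eq rigidity_transpose_apply_def bapply_def)
  moreover have "((\<lambda>s. stacked (p s) r) has_vector_derivative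
      closed_loop_rhs \<Gamma> \<tau> V0 E0 T d2 (p t) r) (at t within J)"
    using sol t r by (simp add: closed_loop_solution_def)
  moreover have "stacked (p s) r = p s $ i" for s
    by (simp add: r_def stacked_Inl stacked_Inr)
  ultimately show "((\<lambda>s. p s $ i) has_vector_derivative
      (- dual_force \<Gamma> \<tau> V0 E0 T (($) (p t)) (error_vector \<Gamma> \<tau> V0 E0 T d2 (p t))) $ i) (at t within J)"
    by simp
qed

lemma bounded_linear_q_bar: "bounded_linear (\<lambda>p. q_bar \<Gamma> \<tau> p k)"
  unfolding linear_conv_bounded_linear[symmetric] q_bar_def bapply_def
  by (intro linearI)
    (auto simp: algebra_simps sum.distrib scaleR_sum_right)

text \<open>
  Applying the error map to the velocity \<open>- dual_force e\<close> multiplies out to the right-hand sides of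
  the error system.
\<close>

lemma q_bar_dual_force:
  "q_bar \<Gamma> \<tau> (- dual_force \<Gamma> \<tau> V0 E0 T x (error_vector \<Gamma> \<tau> V0 E0 T d2 p)) k
    = q_rhs \<Gamma> \<tau> V0 E0 T x (sigma_bar \<tau> V0 d2 p) (q_bar \<Gamma> \<tau> p) k"
proof -
  let ?C = "tree_columns V0 T" and ?s = "rigidity_transpose_apply E0 \<tau> x (sigma_bar \<tau> V0 d2 p)"
  let ?q = "bapply (tree_columns V0 T) (Ebar \<Gamma> \<tau>) (q_bar \<Gamma> \<tau> p)"
  have force: "dual_force \<Gamma> \<tau> V0 E0 T x (error_vector \<Gamma> \<tau> V0 E0 T d2 p) $ w
      = (if w \<in> V0 then ?s w else 0) + ?q w" for w
    by (simp add: dual_force_def error_vector_def rigidity_transpose_apply_def bapply_def)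
  have 1: "(\<Sum>w\<in>UNIV. transpose (Ebar \<Gamma> \<tau> w k) *v (if w \<in> V0 then ?s w else 0))
      = bapply V0 (btranspose (Ebar0 \<Gamma> \<tau>)) ?s k"
    unfolding bapply_def Ebar0_eq btranspose_def by (rule sum.mono_neutral_cong_right) auto
  have "(\<Sum>w\<in>UNIV. transpose (Ebar \<Gamma> \<tau> w k) *v ?q w)
      = (\<Sum>w\<in>UNIV. \<Sum>l\<in>?C. (transpose (Ebar \<Gamma> \<tau> w k) ** Ebar \<Gamma> \<tau> w l) *v q_bar \<Gamma> \<tau> p l)"
    by (simp add: bapply_def matrix_vector_mult_sum matrix_vector_mul_assoc)
  also have "\<dots> = bapply ?C (bmult UNIV (btranspose (Ebar \<Gamma> \<tau>)) (Ebar \<Gamma> \<tau>)) (q_bar \<Gamma> \<tau> p) k"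
    by (subst sum.swap) (simp add: bapply_def bmult_def btranspose_def sum_matrix_vector_mult)
  finally have 2: "(\<Sum>w\<in>UNIV. transpose (Ebar \<Gamma> \<tau> w k) *v ?q w)
      = bapply ?C (bmult UNIV (btranspose (Ebar \<Gamma> \<tau>)) (Ebar \<Gamma> \<tau>)) (q_bar \<Gamma> \<tau> p) k" .
  have "q_bar \<Gamma> \<tau> (- dual_force \<Gamma> \<tau> V0 E0 T x (error_vector \<Gamma> \<tau> V0 E0 T d2 p)) k
      = - q_bar \<Gamma> \<tau> (dual_force \<Gamma> \<tau> V0 E0 T x (error_vector \<Gamma> \<tau> V0 E0 T d2 p)) k"
    by (rule linear_neg[OF bounded_linear.linear[OF bounded_linear_q_bar]])
  then show ?thesis
    unfolding q_rhs_def 1[symmetric] 2[symmetric]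
    by (simp add: q_bar_def bapply_def[of UNIV] btranspose_def force matrix_vector_right_distrib sum.distrib)
qed

lemma rigidity_apply_dual_force:
  "2 * rigidity_apply V0 \<tau> x (($) (- dual_force \<Gamma> \<tau> V0 E0 T x (error_vector \<Gamma> \<tau> V0 E0 T d2 p))) g
    = sigma_rhs \<Gamma> \<tau> V0 E0 T x (sigma_bar \<tau> V0 d2 p) (q_bar \<Gamma> \<tau> p) g"
  by (simp add: rigidity_apply_def sigma_rhs_def dual_force_def error_vector_def Ebar0_eq
      rigidity_transpose_apply_def bapply_def inner_add_right sum.distrib inner_diff_right
      sum_subtractf sum_negf)

lemma norm_squared_derivative:
  fixes f :: "real \<Rightarrow> 'a::real_inner"
  assumes "(f has_vector_derivative f') (at t within J)"
  shows "((\<lambda>s. (norm (f s))\<^sup>2) has_real_derivative 2 * (f t \<bullet> f')) (at t within J)"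
proof -
  have "(f has_derivative (\<lambda>h. h *\<^sub>R f')) (at t within J)"
    using assms by (simp add: has_vector_derivative_def)
  from has_derivative_inner[OF this this] show ?thesis
    unfolding has_field_derivative_def dot_square_norm
    by (rule has_derivative_eq_rhs) (simp add: fun_eq_iff inner_commute)
qed

lemma origin_is_equilibrium:
  "sigma_rhs \<Gamma> \<tau> V0 E0 T x (\<lambda>_. 0) (\<lambda>_. 0) g = 0" "q_rhs \<Gamma> \<tau> V0 E0 T x (\<lambda>_. 0) (\<lambda>_. 0) k = 0"
  by (simp_all add: sigma_rhs_def q_rhs_def rigidity_apply_def rigidity_transpose_apply_def bapply_def)

context free_orthogonal_action
begin

lemma sigma_bar_eq:
  assumes "a \<in> V0" "b \<in> V0" "\<gamma> \<in> \<Gamma>"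
  shows "sigma_bar \<tau> V0 d2 p (a, b, \<gamma>) = (norm (p $ a - \<tau> \<gamma> *v p $ b))\<^sup>2 - d2 (a, b, \<gamma>)"
  by (simp add: sigma_bar_def p0_part_eq rigidity_apply_eq[OF assms] dot_square_norm)

lemma sigma_bar_derivative:
  assumes "g \<in> V0 \<times> V0 \<times> \<Gamma>" and "(p has_vector_derivative p') (at t within J)"
  shows "((\<lambda>s. sigma_bar \<tau> V0 d2 (p s) g) has_real_derivative
      2 * rigidity_apply V0 \<tau> (($) (p t)) (($) p') g) (at t within J)"
proof -
  obtain a b \<gamma> where g: "g = (a, b, \<gamma>)" "a \<in> V0" "b \<in> V0" "\<gamma> \<in> \<Gamma>" using assms by auto
  let ?h = "\<lambda>p. p $ a - \<tau> \<gamma> *v p $ b"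
  have "bounded_linear ?h"
    by (intro linear_conv_bounded_linear[THEN iffD1] linearI) (auto simp: algebra_simps)
  from DERIV_diff[OF norm_squared_derivative[OF bounded_linear.has_vector_derivative[OF this assms(2)]]
      DERIV_const[of "d2 g"]]
  have "((\<lambda>s. (norm (?h (p s)))\<^sup>2 - d2 g) has_real_derivative 2 * (?h (p t) \<bullet> ?h p')) (at t within J)"
    by simp
  then show ?thesis
    unfolding g(1) sigma_bar_eq[OF g(2-4)] rigidity_apply_eq[OF g(2-4)] .
qed

end

section \<open>Independence of the errors at an isostatic framework\<close>

lemma subspace_error_subspace: "subspace (error_subspace V0 E0 T)"
  by (auto simp: subspace_def error_subspace_def)

lemma oriented_tree_edge:
  assumes "oriented_spanning_tree W (induced_edges E W) A" "(u, v) \<in> A"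
  shows "u \<in> W" "v \<in> W" "u \<noteq> v" "{u, v} \<in> E"
proof -
  have "{u, v} \<in> induced_edges E W"
    using assms unfolding oriented_spanning_tree_def spanning_tree_def by blast
  then show "u \<in> W" "v \<in> W" "{u, v} \<in> E" by (auto simp: induced_edges_def)
  show "u \<noteq> v" using assms by (auto simp: oriented_spanning_tree_def)
qed

lemma Ebar_tree_column:
  assumes "u \<in> vertex_orbit \<Gamma> i" "v \<in> vertex_orbit \<Gamma> i"
  shows "Ebar \<Gamma> \<tau> w (i, u, v) = E_orbit \<Gamma> \<tau> w (u, v)"
  using assms by auto

lemma q_bar_eq:
  assumes "u \<in> vertex_orbit \<Gamma> i" "v \<in> vertex_orbit \<Gamma> i" "u \<noteq> v"
  shows "q_bar \<Gamma> \<tau> p (i, u, v) = p $ u - transpose (\<tau> (gamma_between \<Gamma> u v)) *v p $ v"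
proof -
  let ?M = "\<tau> (gamma_between \<Gamma> u v)"
  have neg: "transpose (- ?M) *v x = - (transpose ?M *v x)" for x
    by (simp add: vec_eq_iff transpose_def matrix_vector_mult_def sum_negf)
  have zero: "transpose (0 :: real^'b^'b) = 0"
    by (simp add: vec_eq_iff transpose_def)
  have "q_bar \<Gamma> \<tau> p (i, u, v)
      = (\<Sum>w\<in>UNIV. (if w = u then p $ w else 0) + (if w = v then - (transpose ?M *v p $ w) else 0))"
    unfolding q_bar_def bapply_def btranspose_def Ebar_tree_column[OF assms(1,2)]
    using assms(3) by (intro sum.cong) (auto simp: neg zero)
  then show ?thesis by (simp add: sum.distrib)
qed

context free_orthogonal_action
begin

lemma q_bar_symmetric:
  assumes sym: "symmetric_vectors \<Gamma> \<tau> p"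
    and uv: "u \<in> vertex_orbit \<Gamma> i" "v \<in> vertex_orbit \<Gamma> i" "u \<noteq> v"
  shows "q_bar \<Gamma> \<tau> p (i, u, v) = 0"
proof -
  obtain \<gamma> where g: "\<gamma> \<in> \<Gamma>" "v = \<gamma> u" using orbit_transporter[OF uv(1,2)] .
  then have "p $ v = \<tau> \<gamma> *v p $ u" using sym by (simp add: symmetric_vectors_def)
  then show ?thesis
    unfolding q_bar_eq[OF uv] using g gamma_between_eq[OF g(1)] by simp
qed

text \<open>
  The blocks of different orbits share no vertex, so the kernel condition splits into one condition
  for each spanning tree.
\<close>

lemma Ebar_injective:
  assumes graph: "simple_graph E"
    and trees: "\<And>i. i \<in> V0 \<Longrightarrow>
      oriented_spanning_tree (vertex_orbit \<Gamma> i) (induced_edges E (vertex_orbit \<Gamma> i)) (T i)"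
    and kernel: "\<And>w. bapply (tree_columns V0 T) (Ebar \<Gamma> \<tau>) q w = 0"
    and k: "k \<in> tree_columns V0 T"
  shows "q k = 0"
proof -
  obtain i c where ic: "k = (i, c)" "i \<in> V0" "c \<in> T i" using k by (auto simp: tree_columns_def)
  let ?O = "vertex_orbit \<Gamma> i"
  note tree = trees[OF ic(2)]
  note edge = oriented_tree_edge[OF tree]
  have "q (i, c) = 0"
  proof (rule forest_incidence_injective[where q = "\<lambda>c. q (i, c)" and A = "T i" and \<Gamma> = \<Gamma> and \<tau> = \<tau>])
    show "simple_graph {{u, v} |u v. (u, v) \<in> T i}"
      using edge(4) graph by (auto simp: simple_graph_def)
    show "(v, u) \<notin> T i" if "(u, v) \<in> T i" for u v
      using tree that by (auto simp: oriented_spanning_tree_def)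
    show "\<nexists>vs. is_cycle {{u, v} |u v. (u, v) \<in> T i} vs"
      using tree by (simp add: oriented_spanning_tree_def spanning_tree_def)
    show "orthogonal_matrix (\<tau> (gamma_between \<Gamma> u v))" if uv: "(u, v) \<in> T i" for u v
    proof -
      obtain \<gamma> where g: "\<gamma> \<in> \<Gamma>" "v = \<gamma> u" using orbit_transporter[OF edge(1)[OF uv] edge(2)[OF uv]] .
      then show ?thesis using gamma_between_eq orthogonal by simp
    qed
    show "(\<Sum>c\<in>T i. E_orbit \<Gamma> \<tau> w c *v q (i, c)) = 0" for w
    proof (cases "w \<in> ?O")
      case False
      then show ?thesis using edge(1,2) by (intro sum.neutral) auto
    next
      case True
      have other: "(\<Sum>c\<in>T j. Ebar \<Gamma> \<tau> w (j, c) *v q (j, c)) = 0" if "j \<in> V0 - {i}" for j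
      proof -
        have "w \<notin> vertex_orbit \<Gamma> j"
          using True that ic(2) representatives unfolding vertex_representatives_def by blast
        then show ?thesis by (intro sum.neutral) auto
      qed
      have "bapply (tree_columns V0 T) (Ebar \<Gamma> \<tau>) q w
          = (\<Sum>j\<in>V0. \<Sum>c\<in>T j. Ebar \<Gamma> \<tau> w (j, c) *v q (j, c))"
        unfolding bapply_def tree_columns_def by (subst sum.Sigma) (simp_all add: case_prod_unfold del: Ebar.simps)
      also have "\<dots> = (\<Sum>c\<in>T i. Ebar \<Gamma> \<tau> w (i, c) *v q (i, c))"
        using other ic(2) by (subst sum.remove[of V0 i]) auto
      also have "\<dots> = (\<Sum>c\<in>T i. E_orbit \<Gamma> \<tau> w c *v q (i, c))"
        using True by (intro sum.cong) auto
      finally show ?thesis using kernel by simp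
    qed
    show "c \<in> T i" by fact
  qed
  then show ?thesis by (simp add: ic)
qed

text \<open>
  The forces \<open>O\<^sup>T \<sigma>\<close> and \<open>Ebar q\<close> cannot cancel unless both vanish. Extend the values of
  \<open>O\<^sup>T \<sigma>\<close> on \<open>V0\<close> to a symmetric vector \<open>y\<close>. Symmetric vectors lie in the kernel of
  \<open>Ebar\<^sup>T\<close>, hence are orthogonal to \<open>Ebar q\<close>, and pairing the total force with \<open>y\<close> leaves
  \<open>\<bar>O\<^sup>T \<sigma>\<bar>\<^sup>2 = 0\<close>. Isostaticity then gives \<open>\<sigma> = 0\<close>, and the trees give \<open>q = 0\<close>.
\<close>

lemma dual_force_injective:
  assumes graph: "simple_graph E"
    and invariant: "\<And>\<gamma> e. \<gamma> \<in> \<Gamma> \<Longrightarrow> e \<in> E \<Longrightarrow> \<gamma> ` e \<in> E"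
    and edges: "edge_representatives E \<Gamma> V0 E0"
    and isostatic: "symmetric_isostatic E \<Gamma> \<tau> p"
    and trees: "\<And>i. i \<in> V0 \<Longrightarrow>
      oriented_spanning_tree (vertex_orbit \<Gamma> i) (induced_edges E (vertex_orbit \<Gamma> i)) (T i)"
    and e: "e \<in> error_subspace V0 E0 T"
    and kernel: "dual_force \<Gamma> \<tau> V0 E0 T (($) p) e = 0"
  shows "e = 0"
proof -
  have sym: "symmetric_vectors \<Gamma> \<tau> p" using isostatic by (simp add: symmetric_isostatic_def)
  define f where "f = rigidity_transpose_apply E0 \<tau> (($) p) (($) (fst e))"
  obtain y where y: "symmetric_vectors \<Gamma> \<tau> y" "\<And>i. i \<in> V0 \<Longrightarrow> y $ i = f i"
    using symmetric_extension[of f] by metis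
  have "q_bar \<Gamma> \<tau> y k = 0" if column: "k \<in> tree_columns V0 T" for k
  proof -
    obtain i u v where k: "k = (i, u, v)" "i \<in> V0" "(u, v) \<in> T i"
      using column by (auto simp: tree_columns_def)
    show ?thesis
      unfolding k(1) by (rule q_bar_symmetric[OF y(1)]) (use oriented_tree_edge[OF trees[OF k(2)] k(3)] in auto)
  qed
  then have "dual_force \<Gamma> \<tau> V0 E0 T (($) p) e \<bullet> y = (\<Sum>g\<in>E0. fst e $ g * rigidity_apply V0 \<tau> (($) p) (($) y) g)"
    by (simp add: dual_force_adjoint)
  also have "\<dots> = (\<Sum>k\<in>V0. f k \<bullet> y $ k)"
    unfolding rigidity_apply_def sum_distrib_left f_def rigidity_transpose_apply_def inner_sum_left
    by (subst sum.swap) simp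
  also have "\<dots> = (\<Sum>k\<in>V0. f k \<bullet> f k)" using y(2) by simp
  finally have "(\<Sum>k\<in>V0. f k \<bullet> f k) = 0" using kernel by simp
  then have f0: "f k = 0" if "k \<in> V0" for k
    using that by (subst (asm) sum_nonneg_eq_0_iff) auto
  have s0: "fst e $ g = 0" if "g \<in> E0" for g
  proof (rule orbit_stress_trivial[OF graph invariant edges sym _ _ that])
    show "\<forall>e\<in>E. \<omega> e = 0" if "self_stress E p \<omega>" "symmetric_stress E \<Gamma> \<omega>" for \<omega>
      using isostatic that by (simp add: symmetric_isostatic_def)
    show "rigidity_transpose_apply E0 \<tau> (($) p) (($) (fst e)) i = 0" if "i \<in> V0" for i
      using f0 that by (simp add: f_def)
  qed auto
  have "bapply (tree_columns V0 T) (Ebar \<Gamma> \<tau>) (($) (snd e)) w = 0" for w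
  proof -
    have "dual_force \<Gamma> \<tau> V0 E0 T (($) p) e $ w = 0" using kernel by simp
    then show ?thesis
      using f0 by (auto simp: dual_force_def f_def split: if_splits)
  qed
  then have "snd e $ k = 0" if "k \<in> tree_columns V0 T" for k
    using Ebar_injective[OF graph trees _ that] by blast
  with s0 e show ?thesis
    unfolding error_subspace_def by (auto simp: prod_eq_iff vec_eq_iff) metis+
qed

end

section \<open>Bounds near an isostatic framework\<close>

lemma norm_vec_le_sum: "norm x \<le> (\<Sum>i\<in>UNIV. norm (x $ i))"
  unfolding norm_vec_def by (rule L2_set_le_sum) simp

lemma linear_dual_force: "linear (dual_force \<Gamma> \<tau> V0 E0 T x)"
proof (rule linearI)
  fix e e' and c :: real
  show "dual_force \<Gamma> \<tau> V0 E0 T x (e + e') = dual_force \<Gamma> \<tau> V0 E0 T x e + dual_force \<Gamma> \<tau> V0 E0 T x e'"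
    by (auto simp: dual_force_def vec_eq_iff rigidity_transpose_apply_def bapply_def
        algebra_simps sum.distrib)
  show "dual_force \<Gamma> \<tau> V0 E0 T x (c *\<^sub>R e) = c *\<^sub>R dual_force \<Gamma> \<tau> V0 E0 T x e"
    by (auto simp: dual_force_def vec_eq_iff rigidity_transpose_apply_def bapply_def
        algebra_simps sum_distrib_left)
qed

text \<open>
  Only the part \<open>O\<^sup>T\<close> of the force map depends on the configuration.
\<close>

lemma norm_dual_force_diff:
  "norm (dual_force \<Gamma> \<tau> V0 E0 T x e - dual_force \<Gamma> \<tau> V0 E0 T y e)
    \<le> norm e * (\<Sum>w\<in>UNIV. \<Sum>g\<in>E0. norm (orbit_rigidity \<tau> x g w - orbit_rigidity \<tau> y g w))"
proof -
  let ?D = "\<lambda>g w. orbit_rigidity \<tau> x g w - orbit_rigidity \<tau> y g w"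
  have le: "\<bar>fst e $ g\<bar> \<le> norm e" for g
    using component_le_norm_cart[of "fst e" g] norm_fst_le[of "fst e" "snd e"] by simp
  have "norm ((dual_force \<Gamma> \<tau> V0 E0 T x e - dual_force \<Gamma> \<tau> V0 E0 T y e) $ w) \<le> (\<Sum>g\<in>E0. norm e * norm (?D g w))" for w
  proof -
    have "norm ((dual_force \<Gamma> \<tau> V0 E0 T x e - dual_force \<Gamma> \<tau> V0 E0 T y e) $ w)
        \<le> norm (\<Sum>g\<in>E0. fst e $ g *\<^sub>R ?D g w)"
      by (simp add: dual_force_def rigidity_transpose_apply_def algebra_simps sum_subtractf)
    also have "\<dots> \<le> (\<Sum>g\<in>E0. \<bar>fst e $ g\<bar> * norm (?D g w))"
      by (rule sum_norm_le) simp
    also have "\<dots> \<le> (\<Sum>g\<in>E0. norm e * norm (?D g w))"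
      by (intro sum_mono mult_right_mono le) simp
    finally show ?thesis .
  qed
  then have "(\<Sum>w\<in>UNIV. norm ((dual_force \<Gamma> \<tau> V0 E0 T x e - dual_force \<Gamma> \<tau> V0 E0 T y e) $ w))
      \<le> (\<Sum>w\<in>UNIV. \<Sum>g\<in>E0. norm e * norm (?D g w))"
    by (rule sum_mono)
  with norm_vec_le_sum have "norm (dual_force \<Gamma> \<tau> V0 E0 T x e - dual_force \<Gamma> \<tau> V0 E0 T y e)
      \<le> (\<Sum>w\<in>UNIV. \<Sum>g\<in>E0. norm e * norm (?D g w))"
    by (rule order_trans)
  then show ?thesis by (simp add: sum_distrib_left)
qed

lemma continuous_matrix_vector_mult [continuous_intros]:
  fixes A :: "real^'n^'m"
  shows "continuous F f \<Longrightarrow> continuous F (\<lambda>x. A *v f x)"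
  unfolding continuous_def by (rule bounded_linear.tendsto[OF matrix_vector_mul_bounded_linear])

lemma continuous_orbit_rigidity [continuous_intros]:
  assumes "continuous F f"
  shows "continuous F (\<lambda>x. orbit_rigidity \<tau> (($) (f x)) g k)"
proof -
  obtain i j \<gamma> where g: "g = (i, j, \<gamma>)" by (cases g)
  show ?thesis
    unfolding g orbit_rigidity.simps using assms
    by (cases "i = j"; cases "k = i"; cases "k = j") (auto intro!: continuous_intros)
qed

text \<open>
  Injectivity at \<open>p\<close> gives a lower bound \<open>m\<close> there, and a perturbation of size at most \<open>m / 2\<close>
  leaves half of it.
\<close>

lemma dual_force_bounds_near:
  fixes p :: "(real^'d)^'v::finite"
  assumes inj: "\<And>e. e \<in> error_subspace V0 E0 T \<Longrightarrow> dual_force \<Gamma> \<tau> V0 E0 T (($) p) e = 0 \<Longrightarrow> e = 0"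
  obtains \<rho> m K where "\<rho> > 0" "m > 0" "K > 0"
    "\<And>x e. dist x p < \<rho> \<Longrightarrow> e \<in> error_subspace V0 E0 T \<Longrightarrow>
      m * norm e \<le> norm (dual_force \<Gamma> \<tau> V0 E0 T (($) x) e) \<and>
      norm (dual_force \<Gamma> \<tau> V0 E0 T (($) x) e) \<le> K * norm e"
proof -
  let ?F = "\<lambda>x. dual_force \<Gamma> \<tau> V0 E0 T (($) x)" 
    and ?S = "error_subspace V0 E0 T :: ('v, 'd) error_space set"
  let ?D = "\<lambda>x. \<Sum>w\<in>UNIV. \<Sum>g\<in>E0. norm (orbit_rigidity \<tau> (($) x) g w - orbit_rigidity \<tau> (($) p) g w)"
  have bl: "bounded_linear (?F p)"
    using linear_dual_force linear_conv_bounded_linear by blast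
  obtain m where m: "m > 0" "\<And>e. e \<in> ?S \<Longrightarrow> m * norm e \<le> norm (?F p e)"
    using injective_imp_isometric[OF closed_subspace[OF subspace_error_subspace] subspace_error_subspace bl] inj
    by blast
  obtain K where K: "K > 0" "\<And>e. norm (?F p e) \<le> norm e * K"
    using bounded_linear.pos_bounded[OF bl] by blast
  have "continuous (at p) ?D"
    by (intro continuous_intros)
  then have "\<forall>\<epsilon>>0. \<exists>\<rho>>0. \<forall>x. dist x p < \<rho> \<longrightarrow> dist (?D x) (?D p) < \<epsilon>"
    by (simp add: continuous_at_eps_delta)
  then obtain \<rho> where \<rho>: "\<rho> > 0" "\<And>x. dist x p < \<rho> \<Longrightarrow> dist (?D x) (?D p) < m / 2"
    using m(1) by (meson half_gt_zero)
  show thesis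
  proof
    show "\<rho> > 0" "m / 2 > 0" "K + m / 2 > 0" using \<rho> m K by auto
    fix x e assume x: "dist x p < \<rho>" and e: "e \<in> ?S"
    have "?D x \<le> m / 2" using \<rho>(2)[OF x] by (simp add: dist_norm)
    then have "norm e * ?D x \<le> norm e * (m / 2)" by (rule mult_left_mono) simp
    then have diff: "norm (?F x e - ?F p e) \<le> norm e * (m / 2)"
      using norm_dual_force_diff order_trans by blast
    have "norm (?F p e) \<le> norm (?F x e) + norm (?F x e - ?F p e)"
      using norm_triangle_ineq4[of "?F x e" "?F x e - ?F p e"] by simp
    moreover have "norm (?F x e) \<le> norm (?F p e) + norm (?F x e - ?F p e)"
      using norm_triangle_ineq[of "?F p e" "?F x e - ?F p e"] by simp
    ultimately show "m / 2 * norm e \<le> norm (?F x e) \<and> norm (?F x e) \<le> (K + m / 2) * norm e"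
      using diff m(2)[OF e] K(2)[of e] by (simp add: algebra_simps)
  qed
qed

section \<open>The Lyapunov function\<close>

text \<open>
  The weights 1/4 and 1/2 absorb the factor 2 by which the squared distances move faster than the
  rows of the orbit rigidity matrix say. With them the derivative along any curve is the pairing of
  \<open>dual_force e\<close> with the velocity.
\<close>

definition lyapunov ::
  "('v::finite \<Rightarrow> 'v) set \<Rightarrow> (('v \<Rightarrow> 'v) \<Rightarrow> real^'d^'d) \<Rightarrow> 'v set \<Rightarrow> 'v gain_edge set
     \<Rightarrow> ('v \<Rightarrow> ('v \<times> 'v) set) \<Rightarrow> ('v gain_edge \<Rightarrow> real) \<Rightarrow> (real^'d)^'v \<Rightarrow> real" where
  "lyapunov \<Gamma> \<tau> V0 E0 T d2 p =
     (\<Sum>g\<in>E0. (sigma_bar \<tau> V0 d2 p g)\<^sup>2) / 4 + (\<Sum>k\<in>tree_columns V0 T. (norm (q_bar \<Gamma> \<tau> p k))\<^sup>2) / 2"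

lemma error_norm_squared:
  "(error_norm V0 E0 T s q)\<^sup>2 = (\<Sum>g\<in>E0. (s g)\<^sup>2) + (\<Sum>k\<in>tree_columns V0 T. (norm (q k))\<^sup>2)"
  by (simp add: error_norm_def sum_nonneg)

lemma lyapunov_bounds:
  shows "lyapunov \<Gamma> \<tau> V0 E0 T d2 p \<ge> 0"
    and "(error_norm V0 E0 T (sigma_bar \<tau> V0 d2 p) (q_bar \<Gamma> \<tau> p))\<^sup>2 \<le> 4 * lyapunov \<Gamma> \<tau> V0 E0 T d2 p"
    and "2 * lyapunov \<Gamma> \<tau> V0 E0 T d2 p \<le> (error_norm V0 E0 T (sigma_bar \<tau> V0 d2 p) (q_bar \<Gamma> \<tau> p))\<^sup>2"
proof -
  have "(\<Sum>g\<in>E0. (sigma_bar \<tau> V0 d2 p g)\<^sup>2) \<ge> 0" "(\<Sum>k\<in>tree_columns V0 T. (norm (q_bar \<Gamma> \<tau> p k))\<^sup>2) \<ge> 0"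
    by (simp_all add: sum_nonneg)
  then show "lyapunov \<Gamma> \<tau> V0 E0 T d2 p \<ge> 0"
    and "(error_norm V0 E0 T (sigma_bar \<tau> V0 d2 p) (q_bar \<Gamma> \<tau> p))\<^sup>2 \<le> 4 * lyapunov \<Gamma> \<tau> V0 E0 T d2 p"
    and "2 * lyapunov \<Gamma> \<tau> V0 E0 T d2 p \<le> (error_norm V0 E0 T (sigma_bar \<tau> V0 d2 p) (q_bar \<Gamma> \<tau> p))\<^sup>2"
    by (simp_all add: error_norm_squared lyapunov_def)
qed

lemma continuous_lyapunov: "continuous (at p) (lyapunov \<Gamma> \<tau> V0 E0 T d2)"
  unfolding lyapunov_def[abs_def] sigma_bar_def p0_part_eq rigidity_apply_def q_bar_def bapply_def
  by (intro continuous_intros) auto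

context free_orthogonal_action
begin

lemma lyapunov_derivative:
  assumes E0: "E0 \<subseteq> V0 \<times> V0 \<times> \<Gamma>"
    and dp: "(p has_vector_derivative p') (at t within J)"
  shows "((\<lambda>s. lyapunov \<Gamma> \<tau> V0 E0 T d2 (p s)) has_real_derivative
      dual_force \<Gamma> \<tau> V0 E0 T (($) (p t)) (error_vector \<Gamma> \<tau> V0 E0 T d2 (p t)) \<bullet> p') (at t within J)"
proof -
  let ?s = "\<lambda>t. sigma_bar \<tau> V0 d2 (p t)" and ?q = "\<lambda>t. q_bar \<Gamma> \<tau> (p t)"
  have s: "((\<lambda>r. (?s r g)\<^sup>2) has_real_derivative
      4 * (?s t g * rigidity_apply V0 \<tau> (($) (p t)) (($) p') g)) (at t within J)" if "g \<in> E0" for g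
    using sigma_bar_derivative[OF subsetD[OF E0 that] dp, of d2]
    by (auto intro!: derivative_eq_intros)
  have q: "((\<lambda>r. (norm (?q r k))\<^sup>2) has_real_derivative 2 * (?q t k \<bullet> q_bar \<Gamma> \<tau> p' k)) (at t within J)" for k
    by (rule norm_squared_derivative[OF bounded_linear.has_vector_derivative[OF bounded_linear_q_bar dp]])
  have "((\<lambda>s. lyapunov \<Gamma> \<tau> V0 E0 T d2 (p s)) has_real_derivative
      (\<Sum>g\<in>E0. 4 * (?s t g * rigidity_apply V0 \<tau> (($) (p t)) (($) p') g)) / 4
      + (\<Sum>k\<in>tree_columns V0 T. 2 * (?q t k \<bullet> q_bar \<Gamma> \<tau> p' k)) / 2) (at t within J)"
    unfolding lyapunov_def
    by (intro DERIV_add DERIV_cdivide DERIV_sum s q)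
  then show ?thesis
    by (simp add: dual_force_adjoint error_vector_def flip: sum_distrib_left)
qed

end

section \<open>Local exponential stability\<close>

theorem theorem4:
  fixes E :: "('v::finite) set set"
    and \<Gamma> :: "('v \<Rightarrow> 'v) set"
    and \<tau> :: "('v \<Rightarrow> 'v) \<Rightarrow> real^'d^'d"
    and V0 :: "'v set"
    and E0 :: "'v gain_edge set"
    and T :: "'v \<Rightarrow> ('v \<times> 'v) set"
    and pstar :: "(real^'d)^'v"
    and d2 :: "'v gain_edge \<Rightarrow> real"
  assumes "simple_graph E"
    and "subgroup \<Gamma> (aut_group E)"
    and "\<tau> \<in> hom (aut_group E\<lparr>carrier := \<Gamma>\<rparr>) orthogonal_group"
    and "free_symmetry \<Gamma>"
    and "symmetric_isostatic E \<Gamma> \<tau> pstar"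
    and "vertex_representatives \<Gamma> V0"
    and "edge_representatives E \<Gamma> V0 E0"
    and "\<forall>g\<in>E0. d2 g = squared_distance \<tau> pstar g"
    and "\<forall>i\<in>V0. connected_graph (vertex_orbit \<Gamma> i) (induced_edges E (vertex_orbit \<Gamma> i))"
    and "\<forall>i\<in>V0. oriented_spanning_tree (vertex_orbit \<Gamma> i) (induced_edges E (vertex_orbit \<Gamma> i)) (T i)"
  shows
    \<comment> \<open>along every solution, the error evolves according to the error system\<close>
    "(\<forall>J p t. is_interval J \<and> 0 \<in> J \<and> J \<subseteq> {0..} \<and>
        closed_loop_solution \<Gamma> \<tau> V0 E0 T d2 J p \<and> t \<in> J \<longrightarrow>
        (\<forall>g\<in>E0. ((\<lambda>s. sigma_bar \<tau> V0 d2 (p s) g) has_real_derivative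
            sigma_rhs \<Gamma> \<tau> V0 E0 T (p0_part (p t)) (sigma_bar \<tau> V0 d2 (p t)) (q_bar \<Gamma> \<tau> (p t)) g)
            (at t within J)) \<and>
        (\<forall>k\<in>tree_columns V0 T. ((\<lambda>s. q_bar \<Gamma> \<tau> (p s) k) has_vector_derivative
            q_rhs \<Gamma> \<tau> V0 E0 T (p0_part (p t)) (sigma_bar \<tau> V0 d2 (p t)) (q_bar \<Gamma> \<tau> (p t)) k)
            (at t within J)))
     \<comment> \<open>the origin is an equilibrium of the error system\<close>
     \<and> (\<forall>x. (\<forall>g\<in>E0. sigma_rhs \<Gamma> \<tau> V0 E0 T x (\<lambda>_. 0) (\<lambda>_. 0) g = 0) \<and>
             (\<forall>k\<in>tree_columns V0 T. q_rhs \<Gamma> \<tau> V0 E0 T x (\<lambda>_. 0) (\<lambda>_. 0) k = 0))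
     \<comment> \<open>local exponential stability\<close>
     \<and> (\<exists>U C r. open U \<and> pstar \<in> U \<and> C > 0 \<and> r > 0 \<and>
          (\<forall>J p. is_interval J \<and> 0 \<in> J \<and> J \<subseteq> {0..} \<and>
             closed_loop_solution \<Gamma> \<tau> V0 E0 T d2 J p \<and> p 0 \<in> U \<longrightarrow>
             (\<forall>t\<in>J. error_norm V0 E0 T (sigma_bar \<tau> V0 d2 (p t)) (q_bar \<Gamma> \<tau> (p t))
                \<le> C * exp (- r * t)
                   * error_norm V0 E0 T (sigma_bar \<tau> V0 d2 (p 0)) (q_bar \<Gamma> \<tau> (p 0)))))"
proof (intro conjI)
  interpret free_orthogonal_action \<Gamma> \<tau> V0
    using free_orthogonal_actionI assms by blast
  have E0: "E0 \<subseteq> V0 \<times> V0 \<times> \<Gamma>" using assms(7) by (simp add: edge_representatives_def)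
  have trees: "oriented_spanning_tree (vertex_orbit \<Gamma> i) (induced_edges E (vertex_orbit \<Gamma> i)) (T i)"
    if "i \<in> V0" for i using assms(10) that by blast
  have invariant: "\<gamma> ` e \<in> E" if \<gamma>: "\<gamma> \<in> \<Gamma>" and e: "e \<in> E" for \<gamma> e
  proof -
    obtain i j where "e = {i, j}" using assms(1) e unfolding simple_graph_def card_2_iff by blast
    then show ?thesis
      using subgroup.mem_carrier[OF assms(2) \<gamma>] e by (simp add: aut_group_def)
  qed
  let ?e = "error_vector \<Gamma> \<tau> V0 E0 T d2" and ?F = "\<lambda>x. dual_force \<Gamma> \<tau> V0 E0 T (($) x)"
  let ?W = "lyapunov \<Gamma> \<tau> V0 E0 T d2"
  let ?N = "\<lambda>x. error_norm V0 E0 T (sigma_bar \<tau> V0 d2 x) (q_bar \<Gamma> \<tau> x)"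
  show "\<forall>J p t. is_interval J \<and> 0 \<in> J \<and> J \<subseteq> {0..} \<and>
        closed_loop_solution \<Gamma> \<tau> V0 E0 T d2 J p \<and> t \<in> J \<longrightarrow>
        (\<forall>g\<in>E0. ((\<lambda>s. sigma_bar \<tau> V0 d2 (p s) g) has_real_derivative
            sigma_rhs \<Gamma> \<tau> V0 E0 T (p0_part (p t)) (sigma_bar \<tau> V0 d2 (p t)) (q_bar \<Gamma> \<tau> (p t)) g)
            (at t within J)) \<and>
        (\<forall>k\<in>tree_columns V0 T. ((\<lambda>s. q_bar \<Gamma> \<tau> (p s) k) has_vector_derivative
            q_rhs \<Gamma> \<tau> V0 E0 T (p0_part (p t)) (sigma_bar \<tau> V0 d2 (p t)) (q_bar \<Gamma> \<tau> (p t)) k)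
            (at t within J))"
  proof (intro allI impI conjI ballI; elim conjE)
    fix J p t g assume sol: "closed_loop_solution \<Gamma> \<tau> V0 E0 T d2 J p" "t \<in> J" and g: "g \<in> E0"
    show "((\<lambda>s. sigma_bar \<tau> V0 d2 (p s) g) has_real_derivative
        sigma_rhs \<Gamma> \<tau> V0 E0 T (p0_part (p t)) (sigma_bar \<tau> V0 d2 (p t)) (q_bar \<Gamma> \<tau> (p t)) g) (at t within J)"
      using sigma_bar_derivative[OF subsetD[OF E0 g] closed_loop_derivative[OF sol], of d2]
      unfolding rigidity_apply_dual_force p0_part_eq .
  next
    fix J p t k assume sol: "closed_loop_solution \<Gamma> \<tau> V0 E0 T d2 J p" "t \<in> J"
    show "((\<lambda>s. q_bar \<Gamma> \<tau> (p s) k) has_vector_derivative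
        q_rhs \<Gamma> \<tau> V0 E0 T (p0_part (p t)) (sigma_bar \<tau> V0 d2 (p t)) (q_bar \<Gamma> \<tau> (p t)) k) (at t within J)"
      using bounded_linear.has_vector_derivative[OF bounded_linear_q_bar closed_loop_derivative[OF sol], of \<Gamma> \<tau> k]
      unfolding q_bar_dual_force p0_part_eq .
  qed
  show "\<forall>x. (\<forall>g\<in>E0. sigma_rhs \<Gamma> \<tau> V0 E0 T x (\<lambda>_. 0) (\<lambda>_. 0) g = 0) \<and>
             (\<forall>k\<in>tree_columns V0 T. q_rhs \<Gamma> \<tau> V0 E0 T x (\<lambda>_. 0) (\<lambda>_. 0) k = 0)"
    by (simp add: origin_is_equilibrium)
  have inj: "e = 0" if "e \<in> error_subspace V0 E0 T" "?F pstar e = 0" for e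
    using dual_force_injective[OF assms(1) _ assms(7,5)] invariant trees that by blast
  obtain \<rho> m K where \<rho>: "\<rho> > 0" and m: "m > 0" and K: "K > 0"
    and bounds: "\<And>x e. dist x pstar < \<rho> \<Longrightarrow> e \<in> error_subspace V0 E0 T \<Longrightarrow>
      m * norm e \<le> norm (?F x e) \<and> norm (?F x e) \<le> K * norm e"
    using dual_force_bounds_near[OF inj] by blast
  \<comment> \<open>The starting points from which paths of the admissible length stay in the ball; the speed bound \<open>K \<bar>e\<bar>\<close> becomes \<open>2 K \<surd>W\<close> because \<open>\<bar>e\<bar>\<^sup>2 \<le> 4 W\<close>.\<close>
  define U where "U = {x. dist x pstar + 2 * K / m\<^sup>2 * sqrt (?W x) < \<rho>}"
  have "\<forall>x. isCont (\<lambda>x. dist x pstar + 2 * K / m\<^sup>2 * sqrt (?W x)) x"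
    by (intro allI continuous_intros continuous_lyapunov)
  then have "open U"
    unfolding U_def by (intro open_Collect_less continuous_on_const) (simp add: continuous_on_eq_continuous_at)
  moreover have "pstar \<in> U"
  proof -
    have "sigma_bar \<tau> V0 d2 pstar g = 0" if "g \<in> E0" for g
      using subsetD[OF E0 that] assms(8) that by (cases g) (auto simp: sigma_bar_eq)
    moreover have "q_bar \<Gamma> \<tau> pstar k = 0" if k: "k \<in> tree_columns V0 T" for k
    proof -
      obtain i u v where k: "k = (i, u, v)" "i \<in> V0" "(u, v) \<in> T i"
        using k by (auto simp: tree_columns_def)
      have "symmetric_vectors \<Gamma> \<tau> pstar" using assms(5) by (simp add: symmetric_isostatic_def)
      then show ?thesis
        unfolding k(1) by (rule q_bar_symmetric) (use oriented_tree_edge[OF trees[OF k(2)] k(3)] in auto)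
    qed
    ultimately have "?W pstar = 0" by (simp add: lyapunov_def)
    then show ?thesis using \<rho> by (simp add: U_def)
  qed
  moreover have "?N (p t) \<le> sqrt 2 * exp (- m\<^sup>2 * t) * ?N (p 0)"
    if J: "is_interval J" "0 \<in> J" "J \<subseteq> {0..}" and sol: "closed_loop_solution \<Gamma> \<tau> V0 E0 T d2 J p"
      and U: "p 0 \<in> U" and t: "t \<in> J" for J p t
  proof -
    note dp = closed_loop_derivative[OF sol]
    have decay: "- ?F (p s) (?e (p s)) \<bullet> ?F (p s) (?e (p s)) \<le> - (2 * m\<^sup>2 * ?W (p s))"
      and speed: "norm (- ?F (p s) (?e (p s))) \<le> 2 * K * sqrt (?W (p s))"
      if near: "dist (p s) pstar < \<rho>" for s
    proof -
      note b = bounds[OF near error_vector_in_subspace, of \<Gamma> \<tau> d2 "p s", unfolded norm_error_vector]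
      have N0: "0 \<le> ?N (p s)" by (simp add: error_norm_def sum_nonneg)
      have "m\<^sup>2 * (2 * ?W (p s)) \<le> m\<^sup>2 * (?N (p s))\<^sup>2"
        by (intro mult_left_mono lyapunov_bounds) simp
      also have "\<dots> = (m * ?N (p s))\<^sup>2" by (simp add: power_mult_distrib)
      also have "\<dots> \<le> (norm (?F (p s) (?e (p s))))\<^sup>2"
        using b m N0 by (intro power_mono) auto
      finally show "- ?F (p s) (?e (p s)) \<bullet> ?F (p s) (?e (p s)) \<le> - (2 * m\<^sup>2 * ?W (p s))"
        by (simp add: dot_square_norm)
      have "?N (p s) \<le> sqrt (4 * ?W (p s))"
        using lyapunov_bounds(2) by (rule real_le_rsqrt)
      then have "?N (p s) \<le> 2 * sqrt (?W (p s))" by (simp add: real_sqrt_mult)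
      then have "K * ?N (p s) \<le> K * (2 * sqrt (?W (p s)))" using K by simp
      then show "norm (- ?F (p s) (?e (p s))) \<le> 2 * K * sqrt (?W (p s))"
        using b by (simp add: mult.assoc mult.left_commute)
    qed
    have "?W (p t) \<le> exp (- (2 * m\<^sup>2 * t)) * ?W (p 0)"
    proof (rule exponential_decay_in_ball[OF J _ _ dp _ _ _ _ _ t])
      show "((\<lambda>s. ?W (p s)) has_real_derivative - ?F (p s) (?e (p s)) \<bullet> ?F (p s) (?e (p s))) (at s within J)"
        if "s \<in> J" for s
        using lyapunov_derivative[OF E0 dp[OF that], of T d2] by simp
      show "dist (p 0) pstar + (2 * K) / m\<^sup>2 * sqrt (?W (p 0)) < \<rho>" using U by (simp add: U_def)
    qed (use m K decay speed lyapunov_bounds(1) in auto)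
    \<comment> \<open>Comparing \<open>W\<close> with the squared error norm at both times costs \<open>4 / 2\<close>, hence the constant \<open>\<surd>2\<close>.\<close>
    then have "(?N (p t))\<^sup>2 \<le> 4 * (exp (- (2 * m\<^sup>2 * t)) * ?W (p 0))"
      using lyapunov_bounds(2)[of V0 E0 T \<tau> d2 "p t" \<Gamma>] by linarith
    also have "\<dots> = 2 * exp (- (2 * m\<^sup>2 * t)) * (2 * ?W (p 0))" by simp
    also have "\<dots> \<le> 2 * exp (- (2 * m\<^sup>2 * t)) * (?N (p 0))\<^sup>2"
      by (intro mult_left_mono lyapunov_bounds) simp
    also have "exp (- (2 * m\<^sup>2 * t)) = (exp (- m\<^sup>2 * t))\<^sup>2"
      by (simp add: power2_eq_square flip: exp_add)
    finally have "(?N (p t))\<^sup>2 \<le> (sqrt 2 * exp (- m\<^sup>2 * t) * ?N (p 0))\<^sup>2"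
      by (simp add: power_mult_distrib)
    then show ?thesis
      by (rule power2_le_imp_le) (simp add: error_norm_def sum_nonneg)
  qed
  ultimately show "\<exists>U C r. open U \<and> pstar \<in> U \<and> C > 0 \<and> r > 0 \<and>
          (\<forall>J p. is_interval J \<and> 0 \<in> J \<and> J \<subseteq> {0..} \<and>
             closed_loop_solution \<Gamma> \<tau> V0 E0 T d2 J p \<and> p 0 \<in> U \<longrightarrow>
             (\<forall>t\<in>J. ?N (p t) \<le> C * exp (- r * t) * ?N (p 0)))"
    using m by (intro exI[of _ U] exI[of _ "sqrt 2"] exI[of _ "m\<^sup>2"]) auto
qed

end
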